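(* For general $\mu$, let $I^{\epsilon}_N=\det[I_{\mu+\epsilon+j-k}(\sqrt t)]_{j,k=1,\dots,N}$ for $\epsilon=0,\pm1$, where $I^0_N\ne0$ for each $N=1,2,\ldots$, and let $r_N=(-1)^N I^{1}_N/I^0_N$, $\bar r_N=(-1)^N I^{-1}_N/I^0_N$. Then $$r_{N}=(-1)^N\Big(\frac{\sqrt t}{2}\Big)^{N}\frac1{(\mu+1)_N}\,\frac{{}_0F_1^{(1)}(;N+1+\mu;t_1,\ldots,t_N)}{{}_0F_1^{(1)}(;N+\mu;t_1,\ldots,t_N)}\bigg|_{t_1=\cdots=t_N=t/4},$$ $$\bar r_{N}=(-1)^N\Big(\frac{2}{\sqrt t}\Big)^{N}(\mu)_N\,\frac{{}_0F_1^{(1)}(;N-1+\mu;t_1,\ldots,t_N)}{{}_0F_1^{(1)}(;N+\mu;t_1,\ldots,t_N)}\bigg|_{t_1=\cdots=t_N=t/4}.$$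
   Context: $I_\alpha(x)$ is the modified Bessel function of the first kind, $\sqrt t$ denotes one and the same square root of $t$ throughout, and $(a)_l=a(a+1)\cdots(a+l-1)$. The $r_N,\bar r_N$ are the reflection coefficients of the orthogonal polynomial system on the unit circle with weight $z^{\mu}e^{\frac12\sqrt t(z+1/z)}$; in general the bar in $\bar r_N$ does not mean complex conjugation. For a partition $\kappa=(\kappa_1\ge\cdots\ge\kappa_N\ge0)$ let $s_\kappa$ be the Schur polynomial, $[a]^{(1)}_\kappa=\prod_{j=1}^N(a-j+1)_{\kappa_j}$, and $h_\kappa=\prod_{(i,j)\in\kappa}[a(i,j)+l(i,j)+1]$ the product of hook lengths ($a(i,j),l(i,j)$ the arm and leg lengths of the node $(i,j)$ of the Young diagram of $\kappa$). The generalised hypergeometric function is $${}_pF_q^{(1)}(a_1,\ldots,a_p;b_1,\ldots,b_q;t_1,\ldots,t_N)=\sum_{\kappa}\frac{[a_1]^{(1)}_\kappa\cdots[a_p]^{(1)}_\kappa}{[b_1]^{(1)}_\kappa\cdots[b_q]^{(1)}_\kappa}\,\frac{s_\kappa(t_1,\ldots,t_N)}{h_\kappa},$$ the sum being over all such partitions $\kappa$. *)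

theory Defs
  imports "HOL-Analysis.Analysis" "Jordan_Normal_Form.Determinant"
begin

text \<open>
  The modified Bessel function of the first kind, with the principal branch of
  \<open>(z/2)\<^sup>\<nu>\<close>.  The case \<open>\<nu> = 0\<close> is separated only because \<open>0 powr 0 = 0\<close> in the
  library, whereas \<open>I\<^sub>0(0) = 1\<close>.  The reciprocal Gamma function is entire, so integer
  orders need no special treatment.
\<close>

definition bessel_I :: "complex \<Rightarrow> complex \<Rightarrow> complex" where
  "bessel_I \<nu> z = (if \<nu> = 0 then 1 else (z / 2) powr \<nu>) *
     (\<Sum>k. (z\<^sup>2 / 4) ^ k / fact k * rGamma (\<nu> + of_nat k + 1))"

text \<open>Only \<open>j - k\<close> enters, so counting the rows and columns from \<open>0\<close> changes nothing.\<close>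

definition bessel_toeplitz :: "complex \<Rightarrow> complex \<Rightarrow> complex \<Rightarrow> nat \<Rightarrow> complex" where
  "bessel_toeplitz \<mu> \<epsilon> s N =
     Determinant.det (Matrix.mat N N (\<lambda>(j, k). bessel_I (\<mu> + \<epsilon> + of_nat j - of_nat k) s))"

definition refl_coeff :: "complex \<Rightarrow> complex \<Rightarrow> nat \<Rightarrow> complex" where
  "refl_coeff \<mu> s N = (-1) ^ N * bessel_toeplitz \<mu> 1 s N / bessel_toeplitz \<mu> 0 s N"

definition refl_coeff_bar :: "complex \<Rightarrow> complex \<Rightarrow> nat \<Rightarrow> complex" where
  "refl_coeff_bar \<mu> s N = (-1) ^ N * bessel_toeplitz \<mu> (-1) s N / bessel_toeplitz \<mu> 0 s N"

text \<open>
  All indices are counted from \<open>0\<close>: the part \<open>\<kappa>\<^sub>i\<^sub>+\<^sub>1\<close> is \<open>\<kappa> i\<close>, the variable \<open>t\<^sub>i\<^sub>+\<^sub>1\<close> is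
  \<open>x i\<close>, and the cell in row \<open>i + 1\<close> and column \<open>j + 1\<close> is \<open>(i, j)\<close>.
  In the next definition \<open>\<kappa> N = 0\<close> forces \<open>\<kappa> i = 0\<close> for all \<open>i \<ge> N\<close>.
\<close>

definition partitions_upto :: "nat \<Rightarrow> (nat \<Rightarrow> nat) set" where
  "partitions_upto N = {\<kappa>. antimono \<kappa> \<and> \<kappa> N = 0}"

definition diagram :: "(nat \<Rightarrow> nat) \<Rightarrow> (nat \<times> nat) set" where
  "diagram \<kappa> = {(i, j). j < \<kappa> i}"

definition arm :: "(nat \<Rightarrow> nat) \<Rightarrow> nat \<Rightarrow> nat \<Rightarrow> nat" where
  "arm \<kappa> i j = card {j'. j < j' \<and> (i, j') \<in> diagram \<kappa>}"

definition leg :: "(nat \<Rightarrow> nat) \<Rightarrow> nat \<Rightarrow> nat \<Rightarrow> nat" where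
  "leg \<kappa> i j = card {i'. i < i' \<and> (i', j) \<in> diagram \<kappa>}"

definition hook_product :: "(nat \<Rightarrow> nat) \<Rightarrow> nat" where
  "hook_product \<kappa> = (\<Prod>(i, j)\<in>diagram \<kappa>. arm \<kappa> i j + leg \<kappa> i j + 1)"

definition semistandard_tableaux :: "nat \<Rightarrow> (nat \<Rightarrow> nat) \<Rightarrow> (nat \<times> nat \<Rightarrow> nat) set" where
  "semistandard_tableaux N \<kappa> = {T \<in> diagram \<kappa> \<rightarrow>\<^sub>E {..<N}.
     (\<forall>i j. (i, Suc j) \<in> diagram \<kappa> \<longrightarrow> T (i, j) \<le> T (i, Suc j)) \<and>
     (\<forall>i j. (Suc i, j) \<in> diagram \<kappa> \<longrightarrow> T (i, j) < T (Suc i, j))}"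

text \<open>
  The tableau sum gives the value of the Schur polynomial also at points with coinciding
  coordinates, where the quotient of alternants is of the form \<open>0/0\<close>.
\<close>

definition schur :: "nat \<Rightarrow> (nat \<Rightarrow> nat) \<Rightarrow> (nat \<Rightarrow> 'a::comm_semiring_1) \<Rightarrow> 'a" where
  "schur N \<kappa> x = (\<Sum>T\<in>semistandard_tableaux N \<kappa>. \<Prod>c\<in>diagram \<kappa>. x (T c))"

definition gen_pochhammer :: "nat \<Rightarrow> complex \<Rightarrow> (nat \<Rightarrow> nat) \<Rightarrow> complex" where
  "gen_pochhammer N a \<kappa> = (\<Prod>i<N. pochhammer (a - of_nat i) (\<kappa> i))"

definition hypergeom_pFq ::
    "nat \<Rightarrow> complex list \<Rightarrow> complex list \<Rightarrow> (nat \<Rightarrow> complex) \<Rightarrow> complex" where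
  "hypergeom_pFq N as bs x = (\<Sum>\<^sub>\<infinity>\<kappa>\<in>partitions_upto N.
     (\<Prod>a\<leftarrow>as. gen_pochhammer N a \<kappa>) / (\<Prod>b\<leftarrow>bs. gen_pochhammer N b \<kappa>) *
     (schur N \<kappa> x / of_nat (hook_product \<kappa>)))"

end

theory Submission
  imports Defs
begin

text \<open>
  Put \<open>\<beta>\<^sub>i = \<kappa>\<^sub>i + N - i\<close>.  The hook length formula and the Weyl dimension formula express
  \<open>s\<^sub>\<kappa>(1, \<dots>, 1) / h\<^sub>\<kappa>\<close> as a constant times \<open>\<Delta>(\<beta>)\<^sup>2 / \<Prod> \<beta>\<^sub>i!\<close> with \<open>\<Delta>\<close> the Vandermonde product,
  so at coinciding arguments \<open>\<^sub>0F\<^sub>1\<close> is a sum of \<open>\<Delta>(\<beta>)\<^sup>2 \<Prod> w(\<beta>\<^sub>i)\<close> over strictly decreasing \<open>\<beta>\<close>,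
  for the weight \<open>w(n) = x\<^sup>n / (n! \<Gamma>(n + 1 + a))\<close>.  By the Andreief identity this is the
  determinant of the moments of \<open>w\<close>.  Taking one factor \<open>\<Delta>(\<beta>)\<close> in the basis of falling
  factorials of \<open>n\<close> and the other one in that of \<open>n + a\<close>, the moments are Bessel series
  whose order depends on the index difference only: the Toeplitz determinant.
\<close>

subsection \<open>Determinants of functions of two indices\<close>

text \<open>Entries come from a function, so that a row is the partial application
  \<open>F i\<close> and replacing rows is composition in the first argument; only indices below
  \<open>N\<close> matter.\<close>

definition fdet :: "nat \<Rightarrow> (nat \<Rightarrow> nat \<Rightarrow> 'a::comm_ring_1) \<Rightarrow> 'a" where
  "fdet N F = Determinant.det (Matrix.mat N N (\<lambda>(i, j). F i j))"

lemma fdet_leibniz: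
  "fdet N F = (\<Sum>p | p permutes {..<N}. of_int (sign p) * (\<Prod>i<N. F i (p i)))"
proof -
  have "fdet N F = (\<Sum>p | p permutes {0..<N}. of_int (sign p) *
      (\<Prod>i = 0..<N. Matrix.mat N N (\<lambda>(i, j). F i j) $$ (i, p i)))"
    unfolding fdet_def by (rule Determinant.det_def'[OF mat_carrier])
  also have "\<dots> = (\<Sum>p | p permutes {..<N}. of_int (sign p) * (\<Prod>i<N. F i (p i)))"
    unfolding atLeast0LessThan
  proof (rule sum.cong[OF refl])
    fix p assume p: "p \<in> {p. p permutes {..<N}}"
    have "(\<Prod>i<N. Matrix.mat N N (\<lambda>(i, j). F i j) $$ (i, p i)) = (\<Prod>i<N. F i (p i))"
      using permutes_in_image[of p "{..<N}"] p by (intro prod.cong) auto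
    then show "of_int (sign p) * (\<Prod>i<N. Matrix.mat N N (\<lambda>(i, j). F i j) $$ (i, p i)) =
        of_int (sign p) * (\<Prod>i<N. F i (p i))" by simp
  qed
  finally show ?thesis .
qed

lemma fdet_cong:
  assumes "\<And>i j. i < N \<Longrightarrow> j < N \<Longrightarrow> F i j = G i j"
  shows "fdet N F = fdet N G"
  unfolding fdet_def using assms
  by (intro arg_cong[where f = Determinant.det] eq_matI) auto

lemma fdet_scale_rows: "fdet N (\<lambda>i j. c i * F i j) = (\<Prod>i<N. c i) * fdet N F"
  by (simp add: fdet_leibniz prod.distrib sum_distrib_left mult_ac)

lemma fdet_transpose: "fdet N (\<lambda>i j. F j i) = fdet N F"
proof -
  have "Matrix.mat N N (\<lambda>(i, j). F j i) = transpose_mat (Matrix.mat N N (\<lambda>(i, j). F i j))"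
    by (intro eq_matI) auto
  then show ?thesis
    unfolding fdet_def by (simp add: Determinant.det_transpose[of _ N])
qed

lemma fdet_scale_columns: "fdet N (\<lambda>i j. c j * F i j) = (\<Prod>i<N. c i) * fdet N F"
  using fdet_scale_rows[of N c "\<lambda>i j. F j i"]
    fdet_transpose[of N F] fdet_transpose[of N "\<lambda>i j. c j * F i j"] by simp

lemma fdet_permute_rows:
  assumes "p permutes {..<N}"
  shows "fdet N (\<lambda>i. F (p i)) = of_int (sign p) * fdet N F"
proof -
  have "Matrix.mat N N (\<lambda>(i, j). F (p i) j) =
      Matrix.mat N N (\<lambda>(i, j). Matrix.mat N N (\<lambda>(i, j). F i j) $$ (p i, j))"
    using permutes_in_image[OF assms] by (intro eq_matI) auto
  then show ?thesis
    unfolding fdet_def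
    using Determinant.det_permute_rows[of "Matrix.mat N N (\<lambda>(i, j). F i j)" N p] assms
    by (simp add: atLeast0LessThan)
qed

lemma fdet_eq_0_if_equal_rows:
  assumes "i < N" "j < N" "i \<noteq> j" "\<And>k. F i k = F j k"
  shows "fdet N F = 0"
  unfolding fdet_def
  by (rule Determinant.det_identical_rows[of _ N i j])
     (use assms in auto)

lemma fdet_mult: "fdet N (\<lambda>i k. \<Sum>j<N. F i j * G j k) = fdet N F * fdet N G"
proof -
  have "Matrix.mat N N (\<lambda>(i, k). \<Sum>j<N. F i j * G j k) =
      Matrix.mat N N (\<lambda>(i, j). F i j) * Matrix.mat N N (\<lambda>(i, j). G i j)"
    by (intro eq_matI) (auto simp: scalar_prod_def atLeast0LessThan)
  then show ?thesis
    unfolding fdet_def by (simp add: Determinant.det_mult[of _ N])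
qed

lemma fdet_lower_triangular:
  assumes "\<And>i j. i < j \<Longrightarrow> j < N \<Longrightarrow> F i j = 0"
  shows "fdet N F = (\<Prod>i<N. F i i)"
  unfolding fdet_def using assms
  by (subst Determinant.det_lower_triangular[of N])
     (auto simp: prod_list_diag_prod atLeast0LessThan)

lemma fdet_upper_triangular:
  assumes "\<And>i j. j < i \<Longrightarrow> i < N \<Longrightarrow> F i j = 0"
  shows "fdet N F = (\<Prod>i<N. F i i)"
  using fdet_lower_triangular[of N "\<lambda>i j. F j i"] assms fdet_transpose[of N F] by simp

text \<open>Laplace expansion along column \<open>0\<close>: the only surviving entry sits in row
  \<open>N\<close>, whence the sign.\<close>

lemma fdet_Suc_last_row:
  assumes "\<And>i. i < N \<Longrightarrow> F i 0 = 0"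
  shows "fdet (Suc N) F = (-1) ^ N * F N 0 * fdet N (\<lambda>i j. F i (Suc j))"
proof -
  let ?A = "Matrix.mat (Suc N) (Suc N) (\<lambda>(i, j). F i j)"
  have "fdet (Suc N) F = (\<Sum>i<Suc N. ?A $$ (i, 0) * cofactor ?A i 0)"
    unfolding fdet_def by (rule laplace_expansion_column) auto
  also have "\<dots> = F N 0 * cofactor ?A N 0"
    using assms by simp
  also have "mat_delete ?A N 0 = Matrix.mat N N (\<lambda>(i, j). F i (Suc j))"
    by (intro eq_matI) (auto simp: mat_delete_def)
  then have "cofactor ?A N 0 = (-1) ^ N * fdet N (\<lambda>i j. F i (Suc j))"
    by (simp add: cofactor_def fdet_def)
  finally show ?thesis by (simp add: mult_ac)
qed

text \<open>All rows are changed at once by left multiplication with the upper bidiagonal matrix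
  \<open>?L\<close>, whose diagonal entries are \<open>1\<close>.\<close>

lemma fdet_subtract_next_row:
  "fdet (Suc N) F = fdet (Suc N) (\<lambda>i j. if i < N then F i j - F (Suc i) j else F i j)"
proof -
  let ?L = "\<lambda>i j. if j = i then 1 else if j = Suc i then -1 else (0::'a)"
  have "fdet (Suc N) (\<lambda>i j. if i < N then F i j - F (Suc i) j else F i j) =
      fdet (Suc N) (\<lambda>i k. \<Sum>j<Suc N. ?L i j * F j k)"
  proof (rule fdet_cong)
    fix i k assume i: "i < Suc N"
    have "(\<Sum>j<Suc N. ?L i j * F j k) =
        (\<Sum>j<Suc N. (if j = i then F j k else 0) - (if j = Suc i then F j k else 0))"
      by (intro sum.cong) auto
    also have "\<dots> = F i k - (if i < N then F (Suc i) k else 0)"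
      using i by (simp only: sum_subtractf sum.delta finite_lessThan) auto
    finally show "(if i < N then F i k - F (Suc i) k else F i k) = (\<Sum>j<Suc N. ?L i j * F j k)"
      by simp
  qed
  also have "\<dots> = fdet (Suc N) ?L * fdet (Suc N) F"
    by (rule fdet_mult)
  also have "fdet (Suc N) ?L = 1"
    by (subst fdet_upper_triangular) auto
  finally show ?thesis by simp
qed

text \<open>Multilinearity in the rows: each row runs over its own index set, independently of the
  others.\<close>

lemma sum_PiE_fdet:
  assumes "\<And>i. i < N \<Longrightarrow> finite (B i)"
  shows "(\<Sum>m\<in>PiE {..<N} B. fdet N (\<lambda>i. F i (m i))) = fdet N (\<lambda>i j. \<Sum>b\<in>B i. F i b j)"
proof -
  have "fdet N (\<lambda>i j. \<Sum>b\<in>B i. F i b j) =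
      (\<Sum>p | p permutes {..<N}. of_int (sign p) * (\<Sum>m\<in>PiE {..<N} B. \<Prod>i<N. F i (m i) (p i)))"
    unfolding fdet_leibniz using assms by (subst prod_sum_PiE) auto
  also have "\<dots> = (\<Sum>m\<in>PiE {..<N} B. fdet N (\<lambda>i. F i (m i)))"
    unfolding fdet_leibniz sum_distrib_left by (rule sum.swap)
  finally show ?thesis by simp
qed

text \<open>Both products are monic of degree \<open>k\<close> in \<open>x\<close>, so they differ
  by a combination of lower ones. The coefficients serve every \<open>x\<close>, which makes the
  change of basis a matrix factor.\<close>

lemma newton_basis_change:
  fixes c d :: "nat \<Rightarrow> 'a::comm_ring_1"
  shows "\<exists>u. \<forall>x. (\<Prod>m<k. x - c m) =
    (\<Prod>m<k. x - d m) + (\<Sum>j<k. u j * (\<Prod>m<j. x - d m))"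
proof (induction k)
  case 0
  show ?case by simp
next
  case (Suc k)
  let ?D = "\<lambda>x j. \<Prod>m<j. x - d m"
  from Suc obtain u where u: "\<And>x. (\<Prod>m<k. x - c m) = ?D x k + (\<Sum>j<k. u j * ?D x j)"
    by blast
  define u' where "u' j = (if j = k then 1 else u j)" for j
  have u': "(\<Prod>m<k. x - c m) = (\<Sum>j<Suc k. u' j * ?D x j)" for x
    by (simp add: u u'_def)
  \<comment> \<open>Read off from
    \<open>?D x j * (x - c k) = ?D x (Suc j) + (d j - c k) * ?D x j\<close>.\<close>
  define v where "v j = (if j = 0 then 0 else u' (j - 1)) + u' j * (d j - c k)" for j
  have *: "(\<Prod>m<Suc k. x - c m) = ?D x (Suc k) + (\<Sum>j<Suc k. v j * ?D x j)" for x
  proof -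
    have "(\<Prod>m<Suc k. x - c m) = (\<Sum>j<Suc k. u' j * ?D x j * (x - c k))"
      using u'[of x] by (simp only: prod.lessThan_Suc sum_distrib_right)
    also have "\<dots> = (\<Sum>j<Suc k. u' j * ?D x (Suc j) + u' j * (d j - c k) * ?D x j)"
      by (intro sum.cong) (auto simp: algebra_simps)
    also have "\<dots> = (\<Sum>j<Suc k. u' j * ?D x (Suc j)) + (\<Sum>j<Suc k. u' j * (d j - c k) * ?D x j)"
      by (rule sum.distrib)
    \<comment> \<open>A zero summand at \<open>j = 0\<close> aligns the shifted sum with the other
      one; the top summand has coefficient \<open>u' k = 1\<close>.\<close>
    also have "(\<Sum>j<Suc k. u' j * ?D x (Suc j)) =
        (\<Sum>j<Suc (Suc k). (if j = 0 then 0 else u' (j - 1)) * ?D x j)"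
      by (subst (2) sum.lessThan_Suc_shift) simp
    also have "\<dots> = (\<Sum>j<Suc k. (if j = 0 then 0 else u' (j - 1)) * ?D x j) + ?D x (Suc k)"
      by (simp add: u'_def)
    finally show ?thesis
      by (simp only: v_def distrib_right sum.distrib add_ac)
  qed
  show ?case by (rule exI[of _ v], rule allI, rule *)
qed

text \<open>
  A change of nodes is unitriangular, so the determinant does not depend on \<open>c\<close>; for
  \<open>c = y\<close> the matrix is lower triangular.
\<close>

lemma fdet_newton:
  fixes y c :: "nat \<Rightarrow> 'a::comm_ring_1"
  shows "fdet N (\<lambda>i k. \<Prod>m<k. y i - c m) = (\<Prod>i<N. \<Prod>j<i. y i - y j)"
proof -
  have "\<forall>k. \<exists>u. \<forall>x. (\<Prod>m<k. x - c m) =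
      (\<Prod>m<k. x - y m) + (\<Sum>j<k. u j * (\<Prod>m<j. x - y m))"
    by (intro allI newton_basis_change)
  from choice[OF this] obtain u where u: "(\<Prod>m<k. x - c m) =
      (\<Prod>m<k. x - y m) + (\<Sum>j<k. u k j * (\<Prod>m<j. x - y m))" for k x
    by auto
  let ?U = "\<lambda>j k. if j = k then 1 else if j < k then u k j else 0"
  have "fdet N (\<lambda>i k. \<Prod>m<k. y i - c m) =
      fdet N (\<lambda>i k. \<Sum>j<N. (\<Prod>m<j. y i - y m) * ?U j k)"
  proof (rule fdet_cong)
    fix i k assume k: "k < N"
    have "(\<Sum>j<N. (\<Prod>m<j. y i - y m) * ?U j k) = (\<Sum>j<Suc k. (\<Prod>m<j. y i - y m) * ?U j k)"
      using k by (intro sum.mono_neutral_right) auto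
    also have "\<dots> = (\<Prod>m<k. y i - c m)"
      unfolding u[of _ k] by (simp add: mult.commute)
    finally show "(\<Prod>m<k. y i - c m) = (\<Sum>j<N. (\<Prod>m<j. y i - y m) * ?U j k)" by simp
  qed
  also have "\<dots> = fdet N (\<lambda>i j. \<Prod>m<j. y i - y m) * fdet N ?U"
    by (rule fdet_mult)
  also have "fdet N ?U = 1"
    by (subst fdet_upper_triangular) auto
  also have "fdet N (\<lambda>i j. \<Prod>m<j. y i - y m) = (\<Prod>i<N. \<Prod>j<i. y i - y j)"
    by (subst fdet_lower_triangular) (auto intro!: prod_zero)
  finally show ?thesis by simp
qed

subsection \<open>The hook product\<close>

text \<open>The staircase offset, \<open>N - Suc i\<close> because rows count from \<open>0\<close>,
  turns weak decrease into strict decrease on the indices below \<open>N\<close>.\<close>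

definition beta_number :: "nat \<Rightarrow> (nat \<Rightarrow> nat) \<Rightarrow> nat \<Rightarrow> nat" where
  "beta_number N \<kappa> i = \<kappa> i + (N - Suc i)"

lemma beta_number_strict_decreasing:
  assumes "antimono \<kappa>" "i < j" "j < N"
  shows "beta_number N \<kappa> j < beta_number N \<kappa> i"
  using antimonoD[OF assms(1), of i j] assms(2,3) by (simp add: beta_number_def)

lemma diagram_eq_Sigma:
  assumes "\<kappa> \<in> partitions_upto N"
  shows "diagram \<kappa> = (SIGMA i:{..<N}. {..<\<kappa> i})"
proof -
  have "i < N" if "j < \<kappa> i" for i j
  proof (rule ccontr)
    assume "\<not> i < N"
    then have "\<kappa> i \<le> \<kappa> N" using assms antimonoD[of \<kappa> N i] by (simp add: partitions_upto_def)
    with that assms show False by (simp add: partitions_upto_def)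
  qed
  then show ?thesis by (auto simp: diagram_def)
qed

lemma arm_eq: "arm \<kappa> i j = \<kappa> i - Suc j"
proof -
  have "{j'. j < j' \<and> (i, j') \<in> diagram \<kappa>} = {j<..<\<kappa> i}" by (auto simp: diagram_def)
  then show ?thesis by (simp add: arm_def)
qed

text \<open>Here \<open>c\<close> is the length of column \<open>j\<close>; describing it by the
  rows that reach the column avoids a separate conjugate partition.\<close>

lemma leg_eq:
  assumes "\<And>i. j < \<kappa> i \<longleftrightarrow> i < c"
  shows "leg \<kappa> i j = c - Suc i"
proof -
  have "{i'. i < i' \<and> (i', j) \<in> diagram \<kappa>} = {i<..<c}" by (auto simp: diagram_def assms)
  then show ?thesis by (simp add: leg_def)
qed

text \<open>As \<open>\<kappa>\<close> decreases, the rows reaching beyond column \<open>j\<close>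
  form an initial segment; it is finite because \<open>\<kappa> N = 0\<close>.\<close>

lemma column_length_exists:
  assumes "\<kappa> \<in> partitions_upto N"
  shows "\<exists>c. \<forall>i. j < \<kappa> i \<longleftrightarrow> i < c"
proof (intro exI allI iffI)
  let ?c = "LEAST i. \<kappa> i \<le> j"
  have "\<kappa> N \<le> j" using assms by (simp add: partitions_upto_def)
  then have c: "\<kappa> ?c \<le> j" by (rule LeastI)
  show "i < ?c" if "j < \<kappa> i" for i
  proof (rule ccontr)
    assume "\<not> i < ?c"
    then have "\<kappa> i \<le> \<kappa> ?c" using assms antimonoD[of \<kappa> ?c i] by (simp add: partitions_upto_def)
    with c that show False by simp
  qed
  show "j < \<kappa> i" if "i < ?c" for i
    using not_less_Least[OF that] by simp
qed

text \<open>
  The hook lengths of row \<open>i\<close> and the differences \<open>\<beta>\<^sub>i - \<beta>\<^sub>j\<close>, \<open>j > i\<close>, of beta numbers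
  together are exactly \<open>1, \<dots>, \<beta>\<^sub>i\<close>.
\<close>

lemma hook_row_product:
  assumes \<kappa>: "\<kappa> \<in> partitions_upto N" and i: "i < N"
  shows "(\<Prod>j<\<kappa> i. arm \<kappa> i j + leg \<kappa> i j + 1) *
    (\<Prod>j\<in>{i<..<N}. beta_number N \<kappa> i - beta_number N \<kappa> j) = fact (beta_number N \<kappa> i)"
proof -
  obtain c where c: "\<And>j i. j < \<kappa> i \<longleftrightarrow> i < c j"
    using column_length_exists[OF \<kappa>] by metis
  have anti: "antimono \<kappa>" and \<kappa>N: "\<kappa> N = 0" using \<kappa> by (auto simp: partitions_upto_def)
  have c_le: "c j \<le> N" for j using c[of j N] \<kappa>N by simp
  have c_anti: "c j' \<le> c j" if "j \<le> j'" for j j'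
    using c[of j "c j"] c[of j' "c j"] that by simp
  let ?b = "beta_number N \<kappa>"
  define H where "H j = arm \<kappa> i j + leg \<kappa> i j + 1" for j
  \<comment> \<open>Stated additively, so that truncated subtraction does not interfere.\<close>
  have H: "H j + j + i + 1 = \<kappa> i + c j" if "j < \<kappa> i" for j
    using that c[of j i] by (simp add: H_def arm_eq leg_eq[OF c])
  have b: "?b j + j + 1 = \<kappa> j + N" if "j < N" for j
    using that by (simp add: beta_number_def)
  have b_less: "?b j < ?b i" if "j \<in> {i<..<N}" for j
    using beta_number_strict_decreasing[OF anti, of i j N] that by simp
  \<comment> \<open>Hook lengths strictly decrease along the row, since column lengths do not
    increase.\<close>
  have injH: "inj_on H {..<\<kappa> i}"
  proof (rule linorder_inj_onI)
    fix j j' assume *: "j < j'" "j \<in> {..<\<kappa> i}" "j' \<in> {..<\<kappa> i}"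
    show "H j \<noteq> H j'" using H[of j] H[of j'] c_anti[of j j'] * by simp
  qed auto
  have injb: "inj_on (\<lambda>j. ?b i - ?b j) {i<..<N}"
  proof (rule linorder_inj_onI)
    fix j j' assume *: "j < j'" "j \<in> {i<..<N}" "j' \<in> {i<..<N}"
    show "?b i - ?b j \<noteq> ?b i - ?b j'"
      using beta_number_strict_decreasing[OF anti, of j j' N] b_less[of j] b_less[of j'] * by simp
  qed auto
  \<comment> \<open>A common value would give \<open>\<kappa> j' + c j = j + j' + 1\<close>. If the
    cell \<open>(j', j)\<close> lies in the diagram, the left side is at least
    \<open>j + j' + 2\<close>; otherwise it is at most \<open>j + j'\<close>.\<close>
  have disj: "H ` {..<\<kappa> i} \<inter> (\<lambda>j. ?b i - ?b j) ` {i<..<N} = {}"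
  proof -
    have "H j \<noteq> ?b i - ?b j'" if j: "j < \<kappa> i" and j': "j' \<in> {i<..<N}" for j j'
    proof
      assume "H j = ?b i - ?b j'"
      then have "H j + ?b j' = ?b i" using b_less[OF j'] by simp
      then have "\<kappa> j' + c j = j + j' + 1"
        using H[OF j] b[OF i] b[of j'] j' by simp
      then show False using c[of j j'] by (cases "j < \<kappa> j'") auto
    qed
    then show ?thesis by auto
  qed
  have "H ` {..<\<kappa> i} \<union> (\<lambda>j. ?b i - ?b j) ` {i<..<N} = {1..?b i}"
  proof (rule card_subset_eq)
    have "H j \<in> {1..?b i}" if "j < \<kappa> i" for j
      using H[OF that] c_le[of j] b[OF i] by (simp add: H_def)
    moreover have "?b i - ?b j \<in> {1..?b i}" if "j \<in> {i<..<N}" for j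
      using b_less[OF that] by simp
    ultimately show "H ` {..<\<kappa> i} \<union> (\<lambda>j. ?b i - ?b j) ` {i<..<N} \<subseteq> {1..?b i}" by auto
    \<comment> \<open>Both maps are injective, so the disjoint images have
      \<open>\<kappa> i + (N - Suc i)\<close> elements together, which is
      \<open>?b i\<close>.\<close>
    show "card (H ` {..<\<kappa> i} \<union> (\<lambda>j. ?b i - ?b j) ` {i<..<N}) = card {1..?b i}"
      using disj
      by (simp add: card_Un_disjoint card_image[OF injH] card_image[OF injb])
         (simp add: beta_number_def)
  qed auto
  then have "fact (?b i) = \<Prod>(H ` {..<\<kappa> i} \<union> (\<lambda>j. ?b i - ?b j) ` {i<..<N})"
    by (simp add: fact_prod)
  also have "\<dots> = \<Prod>(H ` {..<\<kappa> i}) * \<Prod>((\<lambda>j. ?b i - ?b j) ` {i<..<N})"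
    using disj by (intro prod.union_disjoint) auto
  finally show ?thesis
    by (simp only: prod.reindex[OF injH] prod.reindex[OF injb] o_def H_def)
qed

lemma hook_product_times_vandermonde:
  assumes \<kappa>: "\<kappa> \<in> partitions_upto N"
  shows "hook_product \<kappa> * (\<Prod>i<N. \<Prod>j<i. beta_number N \<kappa> j - beta_number N \<kappa> i) =
    (\<Prod>i<N. fact (beta_number N \<kappa> i))"
proof -
  let ?b = "beta_number N \<kappa>"
  have "hook_product \<kappa> = (\<Prod>i<N. \<Prod>j<\<kappa> i. arm \<kappa> i j + leg \<kappa> i j + 1)"
    unfolding hook_product_def diagram_eq_Sigma[OF \<kappa>] by (subst prod.Sigma) auto
  \<comment> \<open>Interchanging the products attaches each difference to its smaller index, as in
    \<open>hook_row_product\<close>.\<close>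
  moreover have "(\<Prod>i<N. \<Prod>j<i. ?b j - ?b i) = (\<Prod>i<N. \<Prod>j\<in>{i<..<N}. ?b i - ?b j)"
    by (subst (1 2) prod.Sigma, simp, simp, simp, simp)
       (rule prod.reindex_bij_witness[of _ prod.swap prod.swap], auto)
  ultimately show ?thesis
    using hook_row_product[OF \<kappa>] by (simp add: prod.distrib[symmetric])
qed

subsection \<open>Counting semistandard tableaux\<close>

lemma finite_down_closed_nat:
  fixes S :: "nat set"
  assumes "finite S" "\<And>x y. x \<in> S \<Longrightarrow> y < x \<Longrightarrow> y \<in> S"
  shows "S = {..<card S}"
proof (cases "S = {}")
  case False
  have "S = {..Max S}"
    using assms(2)[OF Max_in[OF assms(1) False]] Max_in[OF assms(1) False] Max_ge[OF assms(1)]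
    by (auto simp: le_less)
  then show ?thesis by (metis card_atMost lessThan_Suc_atMost)
qed simp

section \<open>Branching of tableaux by their largest entry\<close>

lemma semistandard_tableauxI:
  assumes "\<And>i j. (i, j) \<in> diagram \<kappa> \<Longrightarrow> T (i, j) < N" "T \<in> extensional (diagram \<kappa>)"
    and "\<And>i j. (i, Suc j) \<in> diagram \<kappa> \<Longrightarrow> T (i, j) \<le> T (i, Suc j)"
    and "\<And>i j. (Suc i, j) \<in> diagram \<kappa> \<Longrightarrow> T (i, j) < T (Suc i, j)"
  shows "T \<in> semistandard_tableaux N \<kappa>"
  using assms unfolding semistandard_tableaux_def by (auto simp: PiE_def)

lemma semistandard_tableaux_undefined:
  "T \<in> semistandard_tableaux N \<kappa> \<Longrightarrow> c \<notin> diagram \<kappa> \<Longrightarrow> T c = undefined"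
  unfolding semistandard_tableaux_def by (elim CollectE conjE) (rule PiE_arb)

lemma finite_semistandard_tableaux:
  assumes "\<kappa> \<in> partitions_upto M"
  shows "finite (semistandard_tableaux N \<kappa>)"
proof (rule finite_subset)
  show "semistandard_tableaux N \<kappa> \<subseteq> diagram \<kappa> \<rightarrow>\<^sub>E {..<N}"
    by (auto simp: semistandard_tableaux_def)
  show "finite (diagram \<kappa> \<rightarrow>\<^sub>E {..<N})"
    by (intro finite_PiE) (auto simp: diagram_eq_Sigma[OF assms])
qed

lemma diagram_left: "(i, Suc j) \<in> diagram \<kappa> \<Longrightarrow> (i, j) \<in> diagram \<kappa>"
  by (simp add: diagram_def)

lemma diagram_up: "antimono \<kappa> \<Longrightarrow> (Suc i, j) \<in> diagram \<kappa> \<Longrightarrow> (i, j) \<in> diagram \<kappa>"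
  using antimonoD[of \<kappa> i "Suc i"] by (simp add: diagram_def)

text \<open>Interlacing tuples are \<open>undefined\<close> from \<open>N\<close> on, whereas a
  partition has to be \<open>0\<close> there.\<close>

definition extend_0 :: "nat \<Rightarrow> (nat \<Rightarrow> nat) \<Rightarrow> nat \<Rightarrow> nat" where
  "extend_0 N v i = (if i < N then v i else 0)"

text \<open>A product of independent intervals, so that sums over it can be taken row by row with
  \<open>sum_PiE_fdet\<close>; weak decrease of the tuples is automatic.\<close>

definition interlacing :: "nat \<Rightarrow> (nat \<Rightarrow> nat) \<Rightarrow> (nat \<Rightarrow> nat) set" where
  "interlacing N \<kappa> = PiE {..<N} (\<lambda>i. {\<kappa> (Suc i)..\<kappa> i})"

lemma extend_0_interlacing:
  assumes "v \<in> interlacing N \<kappa>"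
  shows "extend_0 N v \<in> partitions_upto N"
proof -
  have v: "\<kappa> (Suc i) \<le> v i" "v i \<le> \<kappa> i" if "i < N" for i
    using assms that by (auto simp: interlacing_def PiE_iff)
  have "extend_0 N v (Suc i) \<le> extend_0 N v i" for i
    using v(1)[of i] v(2)[of "Suc i"] by (auto simp: extend_0_def intro: order_trans)
  then show ?thesis
    by (simp add: partitions_upto_def antimono_iff_le_Suc extend_0_def)
qed

text \<open>Removing the largest entry from a tableau leaves a shape interlacing with the old one.\<close>

lemma card_semistandard_tableaux_Suc:
  assumes \<kappa>: "\<kappa> \<in> partitions_upto (Suc N)"
  shows "card (semistandard_tableaux (Suc N) \<kappa>) =
    (\<Sum>v\<in>interlacing N \<kappa>. card (semistandard_tableaux N (extend_0 N v)))"
proof -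
  have anti: "antimono \<kappa>" and \<kappa>0: "\<kappa> (Suc N) = 0" using \<kappa> by (auto simp: partitions_upto_def)
  have row_le: "i \<le> N" if "(i, j) \<in> diagram \<kappa>" for i j
    using that diagram_eq_Sigma[OF \<kappa>] by auto
  \<comment> \<open>Entries are at most \<open>N\<close>; those below \<open>N\<close> fill an
    initial segment of each row, whose length is recorded.\<close>
  define R where "R T = restrict (\<lambda>i. card {j. j < \<kappa> i \<and> T (i, j) < N}) {..<N}"
    for T :: "nat \<times> nat \<Rightarrow> nat"
  define \<Psi> where "\<Psi> T = (R T, restrict T (diagram (extend_0 N (R T))))"
    for T :: "nat \<times> nat \<Rightarrow> nat"
  \<comment> \<open>The inverse map keeps the smaller tableau and fills the remaining cells with
    \<open>N\<close>.\<close>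
  define \<Phi> where "\<Phi> = (\<lambda>(v, T). restrict (\<lambda>c. if c \<in> diagram (extend_0 N v) then T c else N) (diagram \<kappa>))"
  let ?S = "semistandard_tableaux (Suc N) \<kappa>"
  let ?P = "SIGMA v:interlacing N \<kappa>. semistandard_tableaux N (extend_0 N v)"

  have sub: "diagram (extend_0 N v) \<subseteq> diagram \<kappa>" if "v \<in> interlacing N \<kappa>" for v
    using that by (force simp: diagram_def extend_0_def interlacing_def PiE_iff split: if_splits)

  have T_less: "T c < Suc N" if "T \<in> ?S" "c \<in> diagram \<kappa>" for T c
    using that by (auto simp: semistandard_tableaux_def PiE_iff)
  have T_row: "T (i, j) \<le> T (i, Suc j)" if "T \<in> ?S" "(i, Suc j) \<in> diagram \<kappa>" for T i j
    using that by (auto simp: semistandard_tableaux_def)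
  have T_col: "T (i, j) < T (Suc i, j)" if "T \<in> ?S" "(Suc i, j) \<in> diagram \<kappa>" for T i j
    using that by (auto simp: semistandard_tableaux_def)
  have T_row_mono: "T (i, j) \<le> T (i, j')" if T: "T \<in> ?S" and "j \<le> j'" "j' < \<kappa> i" for T i j j'
    using that(2,3)
  proof (induction j' rule: dec_induct)
    case (step n)
    then show ?case using T_row[OF T, of i n] by (simp add: diagram_def)
  qed simp
  \<comment> \<open>Strict columns force this bound. Hence row \<open>N\<close> contains only the
    entry \<open>N\<close>, and the smaller shape has at most \<open>N\<close> rows.\<close>
  have T_ge: "i \<le> T (i, j)" if T: "T \<in> ?S" and "(i, j) \<in> diagram \<kappa>" for T i j
    using that(2)
  proof (induction i)
    case (Suc i)
    then show ?case using T_col[OF T, of i j] diagram_up[OF anti, of i j] by simp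
  qed simp
  have R: "T (i, j) < N \<longleftrightarrow> j < R T i" if T: "T \<in> ?S" and i: "i < N" and j: "j < \<kappa> i" for T i j
  proof -
    let ?A = "{j. j < \<kappa> i \<and> T (i, j) < N}"
    have "?A = {..<card ?A}"
    proof (rule finite_down_closed_nat)
      fix x y assume "x \<in> ?A" "y < x"
      then show "y \<in> ?A" using T_row_mono[OF T, of y x i] by simp
    qed simp
    then have "j \<in> ?A \<longleftrightarrow> j < card ?A" by blast
    then show ?thesis using i j by (simp add: R_def)
  qed
  have R_interlacing: "R T \<in> interlacing N \<kappa>" if T: "T \<in> ?S" for T
  proof -
    \<comment> \<open>The cell above a cell of row \<open>Suc i\<close> has a strictly smaller
      entry, hence one below \<open>N\<close>.\<close>
    have "\<kappa> (Suc i) \<le> R T i" if i: "i < N" for i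
    proof (cases "\<kappa> (Suc i)")
      case (Suc j)
      then have j: "(Suc i, j) \<in> diagram \<kappa>" by (simp add: diagram_def)
      then have "T (i, j) < N" using T_col[OF T j] T_less[OF T j] by simp
      moreover have "j < \<kappa> i" using diagram_up[OF anti j] by (simp add: diagram_def)
      ultimately have "j < R T i" using R[OF T i] by blast
      then show ?thesis using Suc by simp
    qed simp
    moreover have "R T i \<le> \<kappa> i" if i: "i < N" for i
      using card_mono[of "{..<\<kappa> i}" "{j. j < \<kappa> i \<and> T (i, j) < N}"] i by (auto simp: R_def)
    ultimately show ?thesis by (auto simp: interlacing_def R_def)
  qed
  have T_restrict: "restrict T (diagram (extend_0 N (R T))) \<in> semistandard_tableaux N (extend_0 N (R T))"
    if T: "T \<in> ?S" for T
  proof -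
    let ?\<nu> = "extend_0 N (R T)"
    have \<nu>: "antimono ?\<nu>"
      using extend_0_interlacing[OF R_interlacing[OF T]] by (simp add: partitions_upto_def)
    have sub': "c \<in> diagram \<kappa>" if "c \<in> diagram ?\<nu>" for c
      using that sub[OF R_interlacing[OF T]] by blast
    have less: "T (i, j) < N" if "(i, j) \<in> diagram ?\<nu>" for i j
      using R[OF T, of i j] sub'[OF that] that by (auto simp: diagram_def extend_0_def split: if_splits)
    show ?thesis
    proof (rule semistandard_tableauxI)
      fix i j assume ij: "(i, Suc j) \<in> diagram ?\<nu>"
      show "restrict T (diagram ?\<nu>) (i, j) \<le> restrict T (diagram ?\<nu>) (i, Suc j)"
        using T_row[OF T sub'[OF ij]] diagram_left[OF ij] ij by simp
    next
      fix i j assume ij: "(Suc i, j) \<in> diagram ?\<nu>"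
      show "restrict T (diagram ?\<nu>) (i, j) < restrict T (diagram ?\<nu>) (Suc i, j)"
        using T_col[OF T sub'[OF ij]] diagram_up[OF \<nu> ij] ij by simp
    qed (simp_all add: less)
  qed
  have \<Phi>\<Psi>: "\<Phi> (\<Psi> T) = T" if T: "T \<in> ?S" for T
  proof
    fix c :: "nat \<times> nat"
    obtain i j where c: "c = (i, j)" by fastforce
    show "\<Phi> (\<Psi> T) c = T c"
    proof (cases "c \<in> diagram \<kappa>")
      case True
      have "T c = N" if "c \<notin> diagram (extend_0 N (R T))"
      proof (cases "i < N")
        case True
        have "\<not> j < R T i" using that True by (simp add: c diagram_def extend_0_def)
        then have "\<not> T (i, j) < N" using R[OF T True, of j] \<open>c \<in> diagram \<kappa>\<close> by (simp add: c diagram_def)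
        then show ?thesis using T_less[OF T \<open>c \<in> diagram \<kappa>\<close>] c by simp
      next
        case False
        then show ?thesis
          using T_ge[OF T, of i j] T_less[OF T \<open>c \<in> diagram \<kappa>\<close>] \<open>c \<in> diagram \<kappa>\<close> c by simp
      qed
      then show ?thesis using True by (auto simp: \<Phi>_def \<Psi>_def)
    next
      case False
      then show ?thesis
        using semistandard_tableaux_undefined[OF T False] by (auto simp: \<Phi>_def \<Psi>_def)
    qed
  qed
  have \<Phi>_less: "\<Phi> (v, T) (i, j) < N \<longleftrightarrow> j < v i"
    if v: "v \<in> interlacing N \<kappa>" and T: "T \<in> semistandard_tableaux N (extend_0 N v)"
      and i: "i < N" and j: "j < \<kappa> i" for v T i j
    using T i j by (auto simp: \<Phi>_def diagram_def extend_0_def semistandard_tableaux_def PiE_iff)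
  have \<Psi>\<Phi>: "\<Psi> (\<Phi> (v, T)) = (v, T)"
    if v: "v \<in> interlacing N \<kappa>" and T: "T \<in> semistandard_tableaux N (extend_0 N v)" for v T
  proof -
    have "R (\<Phi> (v, T)) = v"
    proof
      fix i
      show "R (\<Phi> (v, T)) i = v i"
      proof (cases "i < N")
        case True
        then have "v i \<le> \<kappa> i" using v by (auto simp: interlacing_def PiE_iff)
        then have "{j. j < \<kappa> i \<and> \<Phi> (v, T) (i, j) < N} = {..<v i}"
          using \<Phi>_less[OF v T True] by auto
        then show ?thesis using True by (simp add: R_def)
      next
        case False
        then show ?thesis using v by (auto simp: R_def interlacing_def PiE_iff extensional_def)
      qed
    qed
    moreover have "restrict (\<Phi> (v, T)) (diagram (extend_0 N v)) = T"
    proof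
      fix c :: "nat \<times> nat"
      show "restrict (\<Phi> (v, T)) (diagram (extend_0 N v)) c = T c"
        using semistandard_tableaux_undefined[OF T, of c] subsetD[OF sub[OF v], of c]
        by (cases "c \<in> diagram (extend_0 N v)") (simp_all add: \<Phi>_def)
    qed
    ultimately show ?thesis by (simp add: \<Psi>_def)
  qed
  have \<Phi>_tableau: "\<Phi> (v, T) \<in> ?S"
    if v: "v \<in> interlacing N \<kappa>" and T: "T \<in> semistandard_tableaux N (extend_0 N v)" for v T
  proof -
    let ?\<nu> = "extend_0 N v"
    have \<nu>: "antimono ?\<nu>"
      using extend_0_interlacing[OF v] by (simp add: partitions_upto_def)
    have less: "T c < N" if "c \<in> diagram ?\<nu>" for c
      using T that by (auto simp: semistandard_tableaux_def PiE_iff)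
    have row: "T (i, j) \<le> T (i, Suc j)" if "(i, Suc j) \<in> diagram ?\<nu>" for i j
      using T that by (auto simp: semistandard_tableaux_def)
    have col: "T (i, j) < T (Suc i, j)" if "(Suc i, j) \<in> diagram ?\<nu>" for i j
      using T that by (auto simp: semistandard_tableaux_def)
    \<comment> \<open>No two added cells share a column: by interlacing, whatever lies directly
      above a cell of \<open>\<kappa>\<close> already belongs to the smaller shape.\<close>
    have above: "(i, j) \<in> diagram ?\<nu>" if "(Suc i, j) \<in> diagram \<kappa>" for i j
    proof -
      have "i < N" using row_le[OF that] by simp
      then have "\<kappa> (Suc i) \<le> v i" using v by (auto simp: interlacing_def PiE_iff)
      then show ?thesis using that \<open>i < N\<close> by (simp add: diagram_def extend_0_def)
    qed
    show ?thesis
    proof (rule semistandard_tableauxI)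
      show "\<Phi> (v, T) (i, j) < Suc N" if "(i, j) \<in> diagram \<kappa>" for i j
        using less[of "(i, j)"] that by (auto simp: \<Phi>_def)
      show "\<Phi> (v, T) \<in> extensional (diagram \<kappa>)" by (simp add: \<Phi>_def)
    next
      fix i j assume ij: "(i, Suc j) \<in> diagram \<kappa>"
      show "\<Phi> (v, T) (i, j) \<le> \<Phi> (v, T) (i, Suc j)"
      proof (cases "(i, Suc j) \<in> diagram ?\<nu>")
        case True
        then show ?thesis using ij diagram_left[OF ij] diagram_left[OF True] row[OF True]
          by (simp add: \<Phi>_def)
      next
        case False
        then show ?thesis using ij diagram_left[OF ij] less[of "(i, j)"] by (auto simp: \<Phi>_def)
      qed
    next
      fix i j assume ij: "(Suc i, j) \<in> diagram \<kappa>"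
      show "\<Phi> (v, T) (i, j) < \<Phi> (v, T) (Suc i, j)"
        using ij diagram_up[OF anti ij] above[OF ij] col[of i j] less[of "(i, j)"]
        by (auto simp: \<Phi>_def)
    qed
  qed
  have "bij_betw \<Psi> ?S ?P"
  proof (rule bij_betw_byWitness[where f' = \<Phi>])
    show "\<forall>T\<in>?S. \<Phi> (\<Psi> T) = T" using \<Phi>\<Psi> by blast
    show "\<forall>p\<in>?P. \<Psi> (\<Phi> p) = p" using \<Psi>\<Phi> by auto
    show "\<Psi> ` ?S \<subseteq> ?P" using R_interlacing T_restrict by (auto simp: \<Psi>_def)
    show "\<Phi> ` ?P \<subseteq> ?S" using \<Phi>_tableau by auto
  qed
  then have "card ?S = card ?P" by (rule bij_betw_same_card)
  also have "\<dots> = (\<Sum>v\<in>interlacing N \<kappa>. card (semistandard_tableaux N (extend_0 N v)))"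
  proof (rule card_SigmaI)
    show "finite (interlacing N \<kappa>)" unfolding interlacing_def by (intro finite_PiE) auto
    show "\<forall>v\<in>interlacing N \<kappa>. finite (semistandard_tableaux N (extend_0 N v))"
      using finite_semistandard_tableaux[OF extend_0_interlacing] by blast
  qed
  finally show ?thesis .
qed

text \<open>Hockey stick identity: Pascal's rule telescopes. The shift \<open>c\<close> takes up the
  staircase offset of the beta numbers.\<close>

lemma sum_choose_shifted:
  fixes a b c k :: nat
  assumes "a \<le> b"
  shows "(\<Sum>x=a..b. of_nat ((x + c) choose k)) =
    (of_nat ((b + Suc c) choose Suc k) - of_nat ((a + c) choose Suc k) :: 'a::ring_1)"
  using assms by (induction b rule: dec_induct) (auto simp: sum.cl_ivl_Suc)

text \<open>Induction along the branching rule. Summing each row over its interval yields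
  differences of consecutive rows of the next larger binomial matrix, and row subtraction followed
  by expansion along its column of ones leads back to that matrix.\<close>

lemma card_semistandard_tableaux_eq_fdet:
  assumes "\<kappa> \<in> partitions_upto N"
  shows "(of_nat (card (semistandard_tableaux N \<kappa>)) :: 'a::comm_ring_1) =
    (-1) ^ (\<Sum>i<N. i) * fdet N (\<lambda>i k. of_nat (beta_number N \<kappa> i choose k))"
  using assms
proof (induction N arbitrary: \<kappa>)
  case 0
  then have "diagram \<kappa> = {}" by (simp add: diagram_eq_Sigma)
  then have "semistandard_tableaux 0 \<kappa> = {\<lambda>_. undefined}"
    by (auto simp: semistandard_tableaux_def)
  then show ?case by (simp add: fdet_leibniz)
next
  case (Suc N)
  let ?b = "beta_number (Suc N) \<kappa>"
  have anti: "antimono \<kappa>" using Suc.prems by (simp add: partitions_upto_def)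
  have "(of_nat (card (semistandard_tableaux (Suc N) \<kappa>)) :: 'a) =
      (\<Sum>v\<in>interlacing N \<kappa>. (-1) ^ (\<Sum>i<N. i) *
        fdet N (\<lambda>i k. of_nat (beta_number N (extend_0 N v) i choose k)))"
    using Suc.IH[OF extend_0_interlacing]
    by (simp add: card_semistandard_tableaux_Suc[OF Suc.prems])
  also have "\<dots> = (-1) ^ (\<Sum>i<N. i) * (\<Sum>v\<in>interlacing N \<kappa>.
        fdet N (\<lambda>i k. of_nat ((v i + (N - Suc i)) choose k)))"
    unfolding sum_distrib_left
    by (intro sum.cong refl arg_cong2[where f = "(*)"] fdet_cong)
       (simp add: beta_number_def extend_0_def)
  also have "(\<Sum>v\<in>interlacing N \<kappa>. fdet N (\<lambda>i k. of_nat ((v i + (N - Suc i)) choose k))) =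
      fdet N (\<lambda>i k. \<Sum>x=\<kappa> (Suc i)..\<kappa> i. of_nat ((x + (N - Suc i)) choose k) :: 'a)"
    unfolding interlacing_def
    by (rule sum_PiE_fdet[where F = "\<lambda>i x k. of_nat ((x + (N - Suc i)) choose k)"]) simp
  also have "\<dots> = fdet N (\<lambda>i k. of_nat (?b i choose Suc k) - of_nat (?b (Suc i) choose Suc k))"
  proof (rule fdet_cong)
    fix i k assume "i < N"
    \<comment> \<open>The upper end of the telescoped sum is the beta number of row
      \<open>i\<close>, the lower end that of row \<open>Suc i\<close>, both for
      \<open>Suc N\<close> rows.\<close>
    moreover from this have "Suc (N - Suc i) = N - i" by simp
    ultimately show "(\<Sum>x=\<kappa> (Suc i)..\<kappa> i. of_nat ((x + (N - Suc i)) choose k)) =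
        of_nat (?b i choose Suc k) - (of_nat (?b (Suc i) choose Suc k) :: 'a)"
      using antimonoD[OF anti, of i "Suc i"]
      by (subst sum_choose_shifted) (simp_all add: beta_number_def)
  qed
  finally have "(of_nat (card (semistandard_tableaux (Suc N) \<kappa>)) :: 'a) =
      (-1) ^ (\<Sum>i<N. i) *
        fdet N (\<lambda>i k. of_nat (?b i choose Suc k) - of_nat (?b (Suc i) choose Suc k))" .
  \<comment> \<open>Column \<open>0\<close> consists of ones, so the differences vanish there except
    in the untouched last row.\<close>
  moreover have "fdet (Suc N) (\<lambda>i k. of_nat (?b i choose k) :: 'a) = (-1) ^ N *
        fdet N (\<lambda>i k. of_nat (?b i choose Suc k) - of_nat (?b (Suc i) choose Suc k))"
    by (subst fdet_subtract_next_row, subst fdet_Suc_last_row)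
       (auto intro!: arg_cong2[where f = "(*)"] fdet_cong)
  ultimately show ?case
    by (simp add: power_add mult.assoc flip: power_mult_distrib)
qed

text \<open>Weyl dimension formula: \<open>fact k * (b choose k)\<close> is the Newton product with
  nodes \<open>0, ..., k - 1\<close>, so the binomial determinant is a Vandermonde product.\<close>

lemma card_semistandard_tableaux_times_facts:
  assumes "\<kappa> \<in> partitions_upto N"
  shows "(of_nat (card (semistandard_tableaux N \<kappa>)) :: 'a::field_char_0) * (\<Prod>k<N. fact k) =
    (\<Prod>i<N. \<Prod>j<i. of_nat (beta_number N \<kappa> j) - of_nat (beta_number N \<kappa> i))"
proof -
  let ?b = "\<lambda>i. of_nat (beta_number N \<kappa> i) :: 'a"
  have "(\<Prod>i<N. \<Prod>j<i. ?b i - ?b j) = fdet N (\<lambda>i k. \<Prod>m<k. ?b i - of_nat m)"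
    by (rule fdet_newton[symmetric])
  also have "\<dots> = fdet N (\<lambda>i k. fact k * of_nat (beta_number N \<kappa> i choose k))"
    by (rule fdet_cong) (simp add: binomial_gbinomial gbinomial_prod_rev atLeast0LessThan)
  also have "\<dots> = (\<Prod>k<N. fact k) * fdet N (\<lambda>i k. of_nat (beta_number N \<kappa> i choose k))"
    by (rule fdet_scale_columns)
  finally have "of_nat (card (semistandard_tableaux N \<kappa>)) * (\<Prod>k<N. fact k) =
      (-1) ^ (\<Sum>i<N. i) * (\<Prod>i<N. \<Prod>j<i. ?b i - ?b j)"
    by (simp add: card_semistandard_tableaux_eq_fdet[OF assms])
  \<comment> \<open>One sign for each pair \<open>j < i\<close> reverses every difference.\<close>
  also have "\<dots> = (\<Prod>i<N. \<Prod>j<i. (-1) * (?b i - ?b j))"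
    by (simp only: power_sum prod.distrib prod_constant card_lessThan)
  finally show ?thesis by simp
qed

subsection \<open>The Andreief identity for series\<close>

lemma has_sum_finite_sum:
  fixes f :: "'a \<Rightarrow> 'b \<Rightarrow> 'c::topological_comm_monoid_add"
  assumes "finite I" "\<And>i. i \<in> I \<Longrightarrow> (f i has_sum s i) A"
  shows "((\<lambda>x. \<Sum>i\<in>I. f i x) has_sum (\<Sum>i\<in>I. s i)) A"
  using assms by (induction I rule: finite_induct) (auto intro: has_sum_add)

text \<open>Multiplies out \<open>N\<close> absolutely convergent series into one unordered sum over
  index tuples.\<close>

lemma has_sum_prod_PiE_nat:
  fixes f :: "nat \<Rightarrow> nat \<Rightarrow> complex"
  assumes "\<And>i. i < N \<Longrightarrow> summable (\<lambda>n. norm (f i n))"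
  shows "((\<lambda>v. \<Prod>i<N. f i (v i)) has_sum (\<Prod>i<N. \<Sum>n. f i n)) ({..<N} \<rightarrow>\<^sub>E UNIV)"
proof -
  have "Infinite_Set_Sum.abs_summable_on (\<lambda>v. \<Prod>i<N. f i (v i)) ({..<N} \<rightarrow>\<^sub>E UNIV)"
    using assms by (intro abs_summable_on_prod_PiE) (auto simp: abs_summable_on_nat_iff')
  then have "(\<lambda>v. \<Prod>i<N. f i (v i)) summable_on ({..<N} \<rightarrow>\<^sub>E UNIV)"
    by (rule abs_summable_summable[OF iffD2[OF abs_summable_equivalent]])
  moreover have f: "infsum (f i) UNIV = (\<Sum>n. f i n)" "f i summable_on UNIV" if "i < N" for i
    using norm_summable_imp_has_sum[OF assms[OF that] summable_sums[OF summable_norm_cancel[OF assms[OF that]]]]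
    by (auto simp: has_sum_iff)
  ultimately show ?thesis
    using infsum_prod_PiE[of "{..<N}" f "\<lambda>_. UNIV"] by (simp add: has_sum_iff)
qed

section \<open>Injective tuples as rearranged beta sequences\<close>

lemma partition_from_strict_decreasing:
  assumes "\<And>i j. i < j \<Longrightarrow> j < N \<Longrightarrow> y j < y i"
  obtains \<kappa> where "\<kappa> \<in> partitions_upto N" "\<And>i. i < N \<Longrightarrow> beta_number N \<kappa> i = y i"
proof
  define \<kappa> where "\<kappa> i = (if i < N then y i - (N - Suc i) else 0)" for i
  \<comment> \<open>Strict decrease leaves room for \<open>N - Suc i\<close> later values below
    \<open>y i\<close>, so the subtraction in \<open>\<kappa>\<close> is exact.\<close>
  have y: "N - Suc i \<le> y i" if "i < N" for i
    using that
  proof (induction "N - Suc i" arbitrary: i)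
    case (Suc n)
    then have "N - Suc (Suc i) \<le> y (Suc i)" by (intro Suc.hyps) auto
    moreover have "y (Suc i) < y i" using Suc by (intro assms) auto
    ultimately show ?case by simp
  qed simp
  have "\<kappa> (Suc i) \<le> \<kappa> i" for i
    using assms[of i "Suc i"] by (auto simp: \<kappa>_def)
  then show "\<kappa> \<in> partitions_upto N"
    by (simp add: partitions_upto_def antimono_iff_le_Suc \<kappa>_def)
  show "beta_number N \<kappa> i = y i" if "i < N" for i
    using y[OF that] that by (simp add: beta_number_def \<kappa>_def)
qed

lemma strict_decreasing_unique:
  fixes y z :: "nat \<Rightarrow> nat"
  assumes "\<And>i j. i < j \<Longrightarrow> j < N \<Longrightarrow> y j < y i" "\<And>i j. i < j \<Longrightarrow> j < N \<Longrightarrow> z j < z i"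
    and "y ` {..<N} = z ` {..<N}" "i < N"
  shows "y i = z i"
proof -
  have sorted: "sorted_wrt (<) (rev (map x [0..<N]))" if "\<And>i j. i < j \<Longrightarrow> j < N \<Longrightarrow> x j < x i"
    for x :: "nat \<Rightarrow> nat"
    unfolding sorted_wrt_rev using that by (auto simp: sorted_wrt_iff_nth_less)
  have "rev (map y [0..<N]) = rev (map z [0..<N])"
    using assms(3) by (intro strict_sorted_equal sorted assms(1,2)) (auto simp: atLeast0LessThan)
  then show ?thesis using assms(4) by simp
qed

text \<open>An injective tuple is a unique rearrangement of a strictly decreasing one, and the
  latter are exactly the beta sequences. Sums over tuples can thus be grouped by partition.\<close>

lemma bij_betw_partitions_permutations:
  "bij_betw (\<lambda>(\<kappa>, p). restrict (\<lambda>i. beta_number N \<kappa> (p i)) {..<N})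
    (partitions_upto N \<times> {p. p permutes {..<N}}) {v \<in> {..<N} \<rightarrow>\<^sub>E UNIV. inj_on v {..<N}}"
  (is "bij_betw ?F ?A ?B")
proof (rule bij_betw_imageI)
  have dec: "beta_number N \<kappa> j < beta_number N \<kappa> i"
    if "\<kappa> \<in> partitions_upto N" "i < j" "j < N" for \<kappa> i j
    using that beta_number_strict_decreasing[of \<kappa> i j N] by (simp add: partitions_upto_def)
  have inj: "inj_on (beta_number N \<kappa>) {..<N}" if "\<kappa> \<in> partitions_upto N" for \<kappa>
    by (rule linorder_inj_onI) (use dec[OF that] in \<open>force+\<close>)
  show "inj_on ?F ?A"
  proof (rule inj_onI, clarify)
    fix \<kappa> p \<kappa>' p'
    assume \<kappa>: "\<kappa> \<in> partitions_upto N" and \<kappa>': "\<kappa>' \<in> partitions_upto N"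
      and p: "p permutes {..<N}" and p': "p' permutes {..<N}"
      and "restrict (\<lambda>i. beta_number N \<kappa> (p i)) {..<N} = restrict (\<lambda>i. beta_number N \<kappa>' (p' i)) {..<N}"
    then have eq: "beta_number N \<kappa> (p i) = beta_number N \<kappa>' (p' i)" if "i < N" for i
      using that by (metis restrict_apply' lessThan_iff)
    have "beta_number N \<kappa> ` {..<N} = (\<lambda>i. beta_number N \<kappa> (p i)) ` {..<N}"
      using permutes_image[OF p] by (metis image_image)
    also have "\<dots> = (\<lambda>i. beta_number N \<kappa>' (p' i)) ` {..<N}"
      by (rule image_cong) (use eq in auto)
    also have "\<dots> = beta_number N \<kappa>' ` {..<N}"
      using permutes_image[OF p'] by (metis image_image)
    finally have img: "beta_number N \<kappa> ` {..<N} = beta_number N \<kappa>' ` {..<N}" .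
    have beta: "beta_number N \<kappa> i = beta_number N \<kappa>' i" if "i < N" for i
      by (rule strict_decreasing_unique[OF dec[OF \<kappa>] dec[OF \<kappa>'] img that])
    have "\<kappa> i = \<kappa>' i" for i
    proof (cases "i < N")
      case True
      then show ?thesis using beta[of i] by (simp add: beta_number_def)
    next
      case False
      then show ?thesis
        using \<kappa> \<kappa>' antimonoD[of \<kappa> N i] antimonoD[of \<kappa>' N i] by (simp add: partitions_upto_def)
    qed
    moreover have "p i = p' i" for i
    proof (cases "i < N")
      case True
      then have "p i < N" "p' i < N" using permutes_in_image[OF p, of i] permutes_in_image[OF p', of i] by auto
      then show ?thesis
        using eq[OF True] beta[of "p' i"] inj_onD[OF inj[OF \<kappa>], of "p i" "p' i"] by simp
    next
      case False
      then show ?thesis using p p' by (simp add: permutes_def)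
    qed
    ultimately show "\<kappa> = \<kappa>' \<and> p = p'" by blast
  qed
  show "?F ` ?A = ?B"
  proof (intro equalityI subsetI)
    fix v assume "v \<in> ?F ` ?A"
    then obtain \<kappa> p where \<kappa>: "\<kappa> \<in> partitions_upto N" and p: "p permutes {..<N}"
      and v: "v = restrict (\<lambda>i. beta_number N \<kappa> (p i)) {..<N}" by auto
    have "inj_on (beta_number N \<kappa> \<circ> p) {..<N}"
      using permutes_image[OF p] permutes_inj_on[OF p] inj[OF \<kappa>] by (intro comp_inj_on) auto
    then have "inj_on v {..<N}"
      by (rule inj_on_cong[THEN iffD1, rotated]) (simp add: v)
    then show "v \<in> ?B" by (simp add: v)
  next
    fix v assume v: "v \<in> ?B"
    define xs where "xs = rev (sorted_list_of_set (v ` {..<N}))"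
    have len: "length xs = N" and set: "set xs = v ` {..<N}" and dist: "distinct xs"
      using v by (simp_all add: xs_def card_image)
    have xs_dec: "xs ! j < xs ! i" if "i < j" "j < N" for i j
    proof -
      have "sorted_wrt (>) xs" by (simp add: xs_def sorted_wrt_rev)
      then show ?thesis using that len by (auto simp: sorted_wrt_iff_nth_less)
    qed
    obtain \<kappa> where \<kappa>: "\<kappa> \<in> partitions_upto N" "\<And>i. i < N \<Longrightarrow> beta_number N \<kappa> i = xs ! i"
      using partition_from_strict_decreasing[of N "(!) xs"] xs_dec by blast
    have bij_xs: "bij_betw ((!) xs) {..<N} (v ` {..<N})"
      using dist set len by (intro bij_betw_nth) auto
    \<comment> \<open>The position of \<open>v i\<close> in the decreasing list \<open>xs\<close> of
      all values.\<close>
    define q where "q = inv_into {..<N} ((!) xs) \<circ> v"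
    have "bij_betw q {..<N} {..<N}"
      unfolding q_def using v
      by (intro bij_betw_trans[OF _ bij_betw_inv_into[OF bij_xs]]) (simp add: bij_betw_def)
    define p where "p i = (if i < N then q i else i)" for i
    have p: "p permutes {..<N}"
    proof (rule bij_imp_permutes)
      show "bij_betw p {..<N} {..<N}"
        by (rule bij_betw_cong[THEN iffD1, OF _ \<open>bij_betw q {..<N} {..<N}\<close>]) (simp add: p_def)
    qed (simp add: p_def)
    have "beta_number N \<kappa> (p i) = v i" if "i < N" for i
    proof -
      have "p i < N" using permutes_in_image[OF p, of i] that by simp
      then show ?thesis
        using that bij_betw_inv_into_right[OF bij_xs, of "v i"] by (simp add: \<kappa> p_def q_def)
    qed
    then have "v = ?F (\<kappa>, p)"
      using v by (auto simp: PiE_iff extensional_def restrict_def fun_eq_iff)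
    then show "v \<in> ?F ` ?A" using \<kappa>(1) p by blast
  qed
qed

text \<open>Leibniz expansion turns the determinant of series into a sum over tuples of a product of
  \<open>f\<close> values times a determinant of \<open>g\<close> values. Grouping the injective
  tuples by partition makes the sum over rearrangements the determinant of \<open>f\<close>.\<close>

lemma andreief_has_sum:
  fixes f g :: "nat \<Rightarrow> nat \<Rightarrow> complex"
  assumes "\<And>j k. j < N \<Longrightarrow> k < N \<Longrightarrow> summable (\<lambda>n. norm (f n j * g n k))"
  shows "((\<lambda>\<kappa>. fdet N (\<lambda>i. f (beta_number N \<kappa> i)) * fdet N (\<lambda>i. g (beta_number N \<kappa> i)))
    has_sum fdet N (\<lambda>j k. \<Sum>n. f n j * g n k)) (partitions_upto N)"
proof -
  let ?S = "fdet N (\<lambda>j k. \<Sum>n. f n j * g n k)"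
  let ?F = "\<lambda>v. (\<Prod>j<N. f (v j) j) * fdet N (\<lambda>j. g (v j))"
  have "((\<lambda>v. \<Sum>p | p permutes {..<N}. of_int (sign p) * (\<Prod>j<N. f (v j) j * g (v j) (p j)))
      has_sum ?S) ({..<N} \<rightarrow>\<^sub>E UNIV)"
    unfolding fdet_leibniz[of N "\<lambda>j k. \<Sum>n. f n j * g n k"]
  proof (intro has_sum_finite_sum has_sum_cmult_right)
    fix p assume p: "p \<in> {p. p permutes {..<N}}"
    show "((\<lambda>v. \<Prod>j<N. f (v j) j * g (v j) (p j)) has_sum (\<Prod>j<N. \<Sum>n. f n j * g n (p j)))
      ({..<N} \<rightarrow>\<^sub>E UNIV)"
      using assms permutes_in_image[of p "{..<N}"] p
      by (intro has_sum_prod_PiE_nat[of N "\<lambda>j n. f n j * g n (p j)"]) auto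
  qed (simp add: finite_permutations)
  then have "(?F has_sum ?S) ({..<N} \<rightarrow>\<^sub>E UNIV)"
    by (simp add: fdet_leibniz sum_distrib_left prod.distrib mult_ac)
  \<comment> \<open>A repeated value gives two equal rows.\<close>
  also have "?this \<longleftrightarrow> (?F has_sum ?S) {v \<in> {..<N} \<rightarrow>\<^sub>E UNIV. inj_on v {..<N}}"
  proof (rule has_sum_cong_neutral)
    fix v :: "nat \<Rightarrow> nat" assume "v \<in> ({..<N} \<rightarrow>\<^sub>E UNIV) - {v \<in> {..<N} \<rightarrow>\<^sub>E UNIV. inj_on v {..<N}}"
    then obtain i j where "i < N" "j < N" "i \<noteq> j" "v i = v j" by (auto simp: inj_on_def)
    then have "fdet N (\<lambda>j. g (v j)) = 0"
      by (intro fdet_eq_0_if_equal_rows[of i N j]) auto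
    then show "?F v = 0" by simp
  qed auto
  also have "\<dots> \<longleftrightarrow> ((\<lambda>z. ?F (case z of (\<kappa>, p) \<Rightarrow> restrict (\<lambda>i. beta_number N \<kappa> (p i)) {..<N})) has_sum ?S)
      (partitions_upto N \<times> {p. p permutes {..<N}})"
    by (rule has_sum_reindex_bij_betw[OF bij_betw_partitions_permutations, symmetric])
  finally show ?thesis
  proof (rule has_sum_SigmaD)
    fix \<kappa>
    let ?b = "beta_number N \<kappa>"
    \<comment> \<open>Undoing the row permutation costs \<open>sign p\<close>, which makes the
      \<open>f\<close> product a Leibniz term.\<close>
    have *: "?F (restrict (\<lambda>i. ?b (p i)) {..<N}) =
        fdet N (\<lambda>i. g (?b i)) * (of_int (sign p) * (\<Prod>i<N. f (?b (p i)) i))"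
      if "p permutes {..<N}" for p
    proof -
      have "fdet N (\<lambda>j. g (restrict (\<lambda>i. ?b (p i)) {..<N} j)) = fdet N (\<lambda>j. g (?b (p j)))"
        by (rule fdet_cong) simp
      then show ?thesis
        using fdet_permute_rows[OF that, of "\<lambda>j. g (?b j)"] by simp
    qed
    have "(\<Sum>p | p permutes {..<N}. ?F (restrict (\<lambda>i. ?b (p i)) {..<N})) =
        (\<Sum>p | p permutes {..<N}. fdet N (\<lambda>i. g (?b i)) *
          (of_int (sign p) * (\<Prod>i<N. f (?b (p i)) i)))"
      by (rule sum.cong[OF refl], rule *) simp
    also have "\<dots> = fdet N (\<lambda>i. g (?b i)) * fdet N (\<lambda>i j. f (?b j) i)"
      by (simp add: fdet_leibniz[of N "\<lambda>i j. f (?b j) i"] sum_distrib_left)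
    also have "fdet N (\<lambda>i j. f (?b j) i) = fdet N (\<lambda>i. f (?b i))"
      by (rule fdet_transpose)
    finally have sum: "(\<Sum>p | p permutes {..<N}. ?F (restrict (\<lambda>i. ?b (p i)) {..<N})) =
        fdet N (\<lambda>i. f (?b i)) * fdet N (\<lambda>i. g (?b i))"
      by (simp only: mult.commute)
    show "((\<lambda>p. ?F (case (\<kappa>, p) of (\<kappa>, p) \<Rightarrow> restrict (\<lambda>i. beta_number N \<kappa> (p i)) {..<N})) has_sum
        fdet N (\<lambda>i. f (?b i)) * fdet N (\<lambda>i. g (?b i))) {p. p permutes {..<N}}"
      unfolding prod.case sum[symmetric]
      by (rule has_sum_finite) (simp add: finite_permutations)
  qed
qed

subsection \<open>The Toeplitz determinant as a hypergeometric series\<close>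

text \<open>The Bessel function without its power factor, in the variable
  \<open>x = z\<^sup>2 / 4\<close>; no branch of a power enters.\<close>

definition bessel_series :: "complex \<Rightarrow> complex \<Rightarrow> complex" where
  "bessel_series \<nu> x = (\<Sum>k. x ^ k / fact k * rGamma (\<nu> + of_nat k + 1))"

lemma summable_norm_bessel_series:
  fixes \<nu> x :: complex
  shows "summable (\<lambda>k. norm (x ^ k / fact k * rGamma (\<nu> + of_nat k + 1)))"
proof -
  \<comment> \<open>From \<open>M\<close> on, \<open>norm ?z\<close> is at least \<open>1\<close>,
    so the reciprocal Gamma values do not grow, and \<open>norm x / (real n + 1)\<close> is at most
    \<open>1 / 2\<close>.\<close>
  obtain M :: nat where M: "norm \<nu> + 2 * norm x + 1 \<le> real M"
    using real_arch_simple by blast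
  show ?thesis
  proof (rule summable_ratio_test[of "1/2" M])
    fix n assume n: "n \<ge> M"
    let ?z = "\<nu> + of_nat n + 1"
    have "norm (of_nat (n + 1) :: complex) \<le> norm ?z + norm \<nu>"
      using norm_triangle_ineq4[of ?z \<nu>] by (simp add: algebra_simps)
    moreover have "norm (of_nat (n + 1) :: complex) = real n + 1"
      by (subst norm_of_nat) simp
    moreover have "real M \<le> real n" using n by simp
    ultimately have z: "1 \<le> norm ?z" using M norm_ge_zero[of x] by linarith
    have "norm (rGamma (?z + 1)) \<le> norm ?z * norm (rGamma (?z + 1))"
      using mult_right_mono[OF z norm_ge_zero[of "rGamma (?z + 1)"]] by simp
    also have "\<dots> = norm (rGamma ?z)" by (simp only: norm_mult[symmetric] rGamma_plus1)
    finally have r: "norm (rGamma (?z + 1)) \<le> norm (rGamma ?z)" .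
    have "norm x / (real n + 1) \<le> 1 / 2"
      using M \<open>real M \<le> real n\<close> norm_ge_zero[of \<nu>] by (simp add: field_simps del: norm_ge_zero)
    then have "norm x / (real n + 1) * (norm (x ^ n / fact n) * norm (rGamma (?z + 1))) \<le>
        1 / 2 * (norm (x ^ n / fact n) * norm (rGamma ?z))"
      using r by (intro mult_mono mult_nonneg_nonneg) auto
    moreover have "norm (x ^ Suc n / fact (Suc n) * rGamma (\<nu> + of_nat (Suc n) + 1)) =
        norm x / (real n + 1) * (norm (x ^ n / fact n) * norm (rGamma (?z + 1)))"
    proof -
      have "\<nu> + of_nat (Suc n) + 1 = ?z + 1" by simp
      moreover have "norm (x ^ Suc n / fact (Suc n)) = norm x / (real n + 1) * norm (x ^ n / fact n)"
        using norm_of_nat[of "Suc n", where ?'a = complex]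
        by (simp add: norm_divide norm_mult norm_power add_ac)
      ultimately show ?thesis by (simp only: norm_mult mult.assoc)
    qed
    ultimately show "norm (norm (x ^ Suc n / fact (Suc n) * rGamma (\<nu> + of_nat (Suc n) + 1))) \<le>
        1 / 2 * norm (norm (x ^ n / fact n * rGamma (\<nu> + of_nat n + 1)))"
      unfolding real_norm_def abs_norm_cancel by (simp only: norm_mult)
  qed simp
qed

text \<open>The power of order \<open>\<mu> + \<epsilon> + j - k\<close> splits into a row factor
  and a column factor; their dependence on \<open>j\<close> and \<open>k\<close> cancels in the
  determinant.\<close>

lemma bessel_toeplitz_eq:
  assumes s: "s \<noteq> 0"
  shows "bessel_toeplitz \<mu> \<epsilon> s N = ((s / 2) powr (\<mu> + \<epsilon>)) ^ N *
    fdet N (\<lambda>j k. bessel_series (\<mu> + \<epsilon> + of_nat j - of_nat k) (s\<^sup>2 / 4))"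
proof -
  let ?G = "\<lambda>j k. bessel_series (\<mu> + \<epsilon> + of_nat j - of_nat k) (s\<^sup>2 / 4)"
  have I: "bessel_I \<nu> s = (s / 2) powr \<nu> * bessel_series \<nu> (s\<^sup>2 / 4)" for \<nu>
    using s by (cases "\<nu> = 0") (simp_all add: bessel_I_def bessel_series_def)
  have pow: "(s / 2) powr of_nat n = (s / 2) ^ n" for n
    using s by (intro powr_complexpow) simp
  have "bessel_I (\<mu> + \<epsilon> + of_nat j - of_nat k) s =
      ((s / 2) powr (\<mu> + \<epsilon>) * (s / 2) ^ j) * (inverse ((s / 2) ^ k) * ?G j k)" for j k
  proof -
    have "(s / 2) powr (\<mu> + \<epsilon> + of_nat j - of_nat k) =
        (s / 2) powr (\<mu> + \<epsilon>) * (s / 2) ^ j * inverse ((s / 2) ^ k)"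
      unfolding powr_diff powr_add[of "s / 2" "\<mu> + \<epsilon>" "of_nat j"] pow by (rule divide_inverse)
    then show ?thesis by (simp only: I mult.assoc)
  qed
  then have "bessel_toeplitz \<mu> \<epsilon> s N =
      fdet N (\<lambda>j k. ((s / 2) powr (\<mu> + \<epsilon>) * (s / 2) ^ j) * (inverse ((s / 2) ^ k) * ?G j k))"
    by (simp add: bessel_toeplitz_def fdet_def)
  also have "\<dots> = (\<Prod>j<N. (s / 2) powr (\<mu> + \<epsilon>) * (s / 2) ^ j) *
      ((\<Prod>k<N. inverse ((s / 2) ^ k)) * fdet N ?G)"
    by (simp only: fdet_scale_rows[of N "\<lambda>j. (s / 2) powr (\<mu> + \<epsilon>) * (s / 2) ^ j"]
        fdet_scale_columns[of N "\<lambda>k. inverse ((s / 2) ^ k)"])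
  also have "\<dots> = ((s / 2) powr (\<mu> + \<epsilon>)) ^ N *
      (\<Prod>j<N. (s / 2) ^ j * inverse ((s / 2) ^ j)) * fdet N ?G"
    by (simp only: prod.distrib prod_constant card_lessThan mult_ac)
  also have "(\<Prod>j<N. (s / 2) ^ j * inverse ((s / 2) ^ j)) = 1"
    using s by (intro prod.neutral) simp
  finally show ?thesis by simp
qed

lemma falling_product_eq_fact:
  "(\<Prod>m<k. of_nat (n + k) - of_nat m :: 'a::field_char_0) = fact (n + k) / fact n"
proof -
  have "(\<Prod>m<k. of_nat (n + k) - of_nat m :: 'a) = fact k * of_nat ((n + k) choose k)"
    by (simp add: binomial_gbinomial gbinomial_prod_rev atLeast0LessThan del: of_nat_add)
  then show ?thesis by (simp add: binomial_fact)
qed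

text \<open>The falling factorial kills the terms with \<open>n < k\<close>; after shifting by
  \<open>k\<close> it reduces the factorial to \<open>fact n\<close>. What remains depends on
  \<open>k - j\<close> only, apart from a column factor.\<close>

lemma moment_series:
  fixes a x :: complex and j k :: nat
  defines "h \<equiv> \<lambda>n. rGamma (of_nat n + 1 + a - of_nat j) *
    (x ^ n / fact n * (\<Prod>m<k. of_nat n - of_nat m))"
  shows "summable (\<lambda>n. norm (h n))" "(\<Sum>n. h n) = x ^ k * bessel_series (a + of_nat k - of_nat j) x"
proof -
  let ?t = "\<lambda>n. x ^ n / fact n * rGamma (a + of_nat k - of_nat j + of_nat n + 1)"
  have shift: "h (n + k) = x ^ k * ?t n" for n
    unfolding h_def falling_product_eq_fact by (simp add: power_add algebra_simps)
  have "h n = 0" if "n < k" for n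
    using that by (auto simp: h_def)
  then have 0: "(\<Sum>n<k. h n) = 0" by simp
  have "summable (\<lambda>n. norm (h (n + k)))"
    unfolding shift norm_mult[of "x ^ k"]
    by (intro summable_mult summable_norm_bessel_series)
  then show s: "summable (\<lambda>n. norm (h n))"
    by (subst (asm) summable_iff_shift)
  have "(\<Sum>n. h n) = (\<Sum>n. h (n + k)) + (\<Sum>n<k. h n)"
    by (rule suminf_split_initial_segment[OF summable_norm_cancel[OF s]])
  also have "\<dots> = x ^ k * bessel_series (a + of_nat k - of_nat j) x"
    unfolding shift 0 bessel_series_def add_0_right
    by (rule suminf_mult[OF summable_norm_cancel[OF summable_norm_bessel_series]])
  finally show "(\<Sum>n. h n) = x ^ k * bessel_series (a + of_nat k - of_nat j) x" .
qed

section \<open>Products of reciprocal Gamma values\<close>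

lemma rGamma_minus_nat:
  "rGamma (z - of_nat j) = rGamma z * (\<Prod>m<j. z - 1 - of_nat m)" for z :: complex
proof (induction j)
  case (Suc j)
  have "rGamma (z - of_nat (Suc j)) = (z - of_nat (Suc j)) * rGamma (z - of_nat (Suc j) + 1)"
    by (simp only: rGamma_plus1)
  also have "z - of_nat (Suc j) + 1 = z - of_nat j" by simp
  finally show ?case by (simp add: Suc algebra_simps)
qed simp

text \<open>Compares the Gamma constants of neighbouring orders; the Pochhammer prefactors of both
  reflection coefficients come from here.\<close>

lemma prod_rGamma_shift:
  "(\<Prod>i<N. rGamma (a + of_nat i)) = pochhammer a N * (\<Prod>i<N. rGamma (a + 1 + of_nat i))"
  for a :: complex
proof -
  have "rGamma (a + of_nat i) = (a + of_nat i) * rGamma (a + 1 + of_nat i)" for i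
    using rGamma_plus1[of "a + of_nat i"] by (simp add: add_ac)
  then show ?thesis by (simp add: prod.distrib pochhammer_prod atLeast0LessThan)
qed

lemma schur_const:
  fixes x :: "'a::comm_semiring_1"
  assumes "\<kappa> \<in> partitions_upto N"
  shows "schur N \<kappa> (\<lambda>_. x) = of_nat (card (semistandard_tableaux N \<kappa>)) * x ^ (\<Sum>i<N. \<kappa> i)"
proof -
  have "card (diagram \<kappa>) = (\<Sum>i<N. \<kappa> i)" by (simp add: diagram_eq_Sigma[OF assms])
  then show ?thesis by (simp add: schur_def)
qed

lemma sum_beta_number: "(\<Sum>i<N. beta_number N \<kappa> i) = (\<Sum>i<N. \<kappa> i) + (\<Sum>i<N. i)"
  by (simp only: beta_number_def sum.distrib sum.nat_diff_reindex[of "\<lambda>i. i" N])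

text \<open>In each row the Pochhammer symbol raises the Gamma argument by
  \<open>\<kappa> i\<close>, so the product no longer depends on \<open>\<kappa>\<close>.\<close>

lemma prod_rGamma_beta_number:
  fixes a :: complex
  shows "gen_pochhammer N (of_nat N + a) \<kappa> *
      (\<Prod>i<N. rGamma (of_nat (beta_number N \<kappa> i) + 1 + a)) =
    (\<Prod>i<N. rGamma (a + 1 + of_nat i))"
proof -
  have "pochhammer (of_nat N + a - of_nat i) (\<kappa> i) * rGamma (of_nat (beta_number N \<kappa> i) + 1 + a) =
      rGamma (a + 1 + of_nat (N - Suc i))" if "i < N" for i
  proof -
    have "(of_nat N :: complex) = of_nat (N - Suc i + i + 1)"
      using that by simp
    then have eqs: "of_nat (beta_number N \<kappa> i) + 1 + a = of_nat N + a - of_nat i + of_nat (\<kappa> i)"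
      "a + 1 + of_nat (N - Suc i) = of_nat N + a - of_nat i"
      by (simp_all add: beta_number_def)
    show ?thesis unfolding eqs by (rule pochhammer_rGamma[symmetric])
  qed
  then have "gen_pochhammer N (of_nat N + a) \<kappa> *
      (\<Prod>i<N. rGamma (of_nat (beta_number N \<kappa> i) + 1 + a)) =
      (\<Prod>i<N. rGamma (a + 1 + of_nat (N - Suc i)))"
    by (simp add: gen_pochhammer_def flip: prod.distrib)
  also have "\<dots> = (\<Prod>i<N. rGamma (a + 1 + of_nat i))"
    by (rule prod.nat_diff_reindex)
  finally show ?thesis .
qed

lemma gen_pochhammer_nonzero:
  assumes "\<And>n::nat. n \<ge> 1 \<Longrightarrow> a \<noteq> - of_nat n"
  shows "gen_pochhammer N (of_nat N + a) \<kappa> \<noteq> 0"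
proof -
  have "pochhammer (of_nat N + a - of_nat i) (\<kappa> i) \<noteq> 0" if "i < N" for i
  proof
    assume "pochhammer (of_nat N + a - of_nat i) (\<kappa> i) = 0"
    then obtain k where "of_nat N + a - of_nat i = - of_nat k"
      by (auto simp: pochhammer_eq_0_iff)
    then have "a = - of_nat (k + (N - i))"
      using that by (simp add: of_nat_diff algebra_simps)
    moreover have "k + (N - i) \<ge> 1" using that by simp
    ultimately show False using assms by blast
  qed
  then show ?thesis by (simp add: gen_pochhammer_def)
qed

text \<open>The Vandermonde product \<open>W\<close> is the tableau count up to the factorials
  \<open>fact k\<close>, and also the quotient of the beta factorials by the hook product. The
  square removes the sign of the ordering.\<close>

lemma tableaux_over_hooks:
  assumes \<kappa>: "\<kappa> \<in> partitions_upto N"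
  shows "of_nat (card (semistandard_tableaux N \<kappa>)) * (\<Prod>k<N. fact k) / of_nat (hook_product \<kappa>) =
    (\<Prod>i<N. \<Prod>j<i. of_nat (beta_number N \<kappa> i) - of_nat (beta_number N \<kappa> j)) ^ 2 /
    (\<Prod>i<N. fact (beta_number N \<kappa> i) :: 'a::field_char_0)"
proof -
  let ?b = "beta_number N \<kappa>"
  define W :: 'a where "W = (\<Prod>i<N. \<Prod>j<i. of_nat (?b j) - of_nat (?b i))"
  have less: "?b i < ?b j" if "j < i" "i < N" for i j
    using \<kappa> that by (intro beta_number_strict_decreasing) (auto simp: partitions_upto_def)
  have W: "W = of_nat (\<Prod>i<N. \<Prod>j<i. ?b j - ?b i)"
    unfolding W_def of_nat_prod using less
    by (intro prod.cong refl) (simp add: of_nat_diff less_imp_le)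
  have "of_nat (?b j) - of_nat (?b i) \<noteq> (0::'a)" if "j < i" "i < N" for i j
    using less[OF that] by simp
  then have "W \<noteq> 0" unfolding W_def by (simp only: prod_zero_iff finite_lessThan) auto
  have hook: "of_nat (hook_product \<kappa>) * W = (\<Prod>i<N. fact (?b i))"
    using arg_cong[OF hook_product_times_vandermonde[OF \<kappa>], of "of_nat :: nat \<Rightarrow> 'a"]
    by (simp only: W of_nat_mult of_nat_prod of_nat_fact)
  have "(\<Prod>i<N. fact (?b i) :: 'a) \<noteq> 0" by simp
  then have "of_nat (hook_product \<kappa>) * W \<noteq> 0" by (simp only: hook not_False_eq_True)
  then have "of_nat (hook_product \<kappa>) \<noteq> (0::'a)" by (rule contrapos_nn) (simp only: mult_zero_left)
  have "(\<Prod>i<N. \<Prod>j<i. of_nat (?b i) - of_nat (?b j) :: 'a) ^ 2 = W ^ 2"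
    unfolding W_def prod_power_distrib by (intro prod.cong refl power2_commute)
  moreover have "of_nat (card (semistandard_tableaux N \<kappa>)) * (\<Prod>k<N. fact k) = W"
    unfolding W_def by (rule card_semistandard_tableaux_times_facts[OF \<kappa>])
  ultimately show ?thesis
    using \<open>W \<noteq> 0\<close> \<open>of_nat (hook_product \<kappa>) \<noteq> 0\<close>
    by (simp add: power2_eq_square flip: hook)
qed

lemma fdet_bessel_series:
  fixes a x :: complex
  assumes a: "\<And>n::nat. n \<ge> 1 \<Longrightarrow> a \<noteq> - of_nat n" and x: "x \<noteq> 0"
  shows "fdet N (\<lambda>j k. bessel_series (a + of_nat j - of_nat k) x) =
    (\<Prod>k<N. fact k) * (\<Prod>i<N. rGamma (a + 1 + of_nat i)) *
    hypergeom_pFq N [] [of_nat N + a] (\<lambda>_. x)"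
proof -
  \<comment> \<open>The weight is split: \<open>f\<close> takes its reciprocal Gamma factor with the
    basis shifted by \<open>a\<close>, \<open>g\<close> the factor \<open>x ^ n / fact n\<close>
    with the falling factorials.\<close>
  define f where "f n j = rGamma (of_nat n + 1 + a - of_nat j)" for n j :: nat
  define g where "g n k = x ^ n / fact n * (\<Prod>m<k. of_nat n - of_nat m)" for n k :: nat
  define term_at where "term_at \<kappa> = 1 / gen_pochhammer N (of_nat N + a) \<kappa> *
    (schur N \<kappa> (\<lambda>_. x) / of_nat (hook_product \<kappa>))" for \<kappa>
  let ?D = "fdet N (\<lambda>j k. bessel_series (a + of_nat j - of_nat k) x)"
  let ?C = "(\<Prod>k<N. fact k) * (\<Prod>i<N. rGamma (a + 1 + of_nat i))"
  have "fdet N (\<lambda>j k. \<Sum>n. f n j * g n k) =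
      fdet N (\<lambda>j k. x ^ k * bessel_series (a + of_nat k - of_nat j) x)"
    unfolding f_def g_def moment_series(2) by (rule refl)
  also have "\<dots> = (\<Prod>k<N. x ^ k) * fdet N (\<lambda>j k. bessel_series (a + of_nat k - of_nat j) x)"
    by (rule fdet_scale_columns)
  also have "fdet N (\<lambda>j k. bessel_series (a + of_nat k - of_nat j) x) = ?D"
    by (rule fdet_transpose)
  finally have lhs: "fdet N (\<lambda>j k. \<Sum>n. f n j * g n k) = x ^ (\<Sum>i<N. i) * ?D"
    by (simp add: power_sum)
  have terms: "fdet N (\<lambda>i. f (beta_number N \<kappa> i)) * fdet N (\<lambda>i. g (beta_number N \<kappa> i)) =
      x ^ (\<Sum>i<N. i) * ?C * term_at \<kappa>" if \<kappa>: "\<kappa> \<in> partitions_upto N" for \<kappa>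
  proof -
    let ?b = "\<lambda>i. of_nat (beta_number N \<kappa> i) :: complex"
    let ?V = "\<Prod>i<N. \<Prod>j<i. ?b i - ?b j"
    \<comment> \<open>Lowering the Gamma argument by \<open>j\<close> multiplies by a Newton product
      with nodes \<open>m - a\<close>.\<close>
    have "fdet N (\<lambda>i. f (beta_number N \<kappa> i)) =
        fdet N (\<lambda>i j. rGamma (?b i + 1 + a) * (\<Prod>m<j. ?b i - (of_nat m - a)))"
      unfolding f_def rGamma_minus_nat
      by (intro fdet_cong arg_cong2[where f = "(*)"] prod.cong refl) simp
    also have "\<dots> = (\<Prod>i<N. rGamma (?b i + 1 + a)) * ?V"
      by (simp only: fdet_scale_rows fdet_newton)
    finally have F: "fdet N (\<lambda>i. f (beta_number N \<kappa> i)) = (\<Prod>i<N. rGamma (?b i + 1 + a)) * ?V" .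
    have "fdet N (\<lambda>i. g (beta_number N \<kappa> i)) =
        (\<Prod>i<N. x ^ beta_number N \<kappa> i / fact (beta_number N \<kappa> i)) * ?V"
      unfolding g_def by (simp only: fdet_scale_rows fdet_newton)
    also have "(\<Prod>i<N. x ^ beta_number N \<kappa> i / fact (beta_number N \<kappa> i)) =
        x ^ (\<Sum>i<N. \<kappa> i) * x ^ (\<Sum>i<N. i) / (\<Prod>i<N. fact (beta_number N \<kappa> i))"
      by (simp only: prod_dividef power_sum[symmetric] sum_beta_number power_add)
    finally have G: "fdet N (\<lambda>i. g (beta_number N \<kappa> i)) =
        x ^ (\<Sum>i<N. \<kappa> i) * x ^ (\<Sum>i<N. i) / (\<Prod>i<N. fact (beta_number N \<kappa> i)) * ?V" .
    let ?P = "gen_pochhammer N (of_nat N + a) \<kappa>" and ?Q = "\<Prod>i<N. rGamma (?b i + 1 + a)"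
    have "?P \<noteq> 0" by (rule gen_pochhammer_nonzero[OF a])
    have "fdet N (\<lambda>i. f (beta_number N \<kappa> i)) * fdet N (\<lambda>i. g (beta_number N \<kappa> i)) =
        x ^ (\<Sum>i<N. \<kappa> i) * x ^ (\<Sum>i<N. i) * ?Q * (?V ^ 2 / (\<Prod>i<N. fact (beta_number N \<kappa> i)))"
      by (simp add: F G power2_eq_square)
    also have "\<dots> = x ^ (\<Sum>i<N. \<kappa> i) * x ^ (\<Sum>i<N. i) * ?Q *
        (of_nat (card (semistandard_tableaux N \<kappa>)) * (\<Prod>k<N. fact k) / of_nat (hook_product \<kappa>))"
      by (simp only: tableaux_over_hooks[OF \<kappa>])
    \<comment> \<open>Inserting \<open>?P\<close> and its inverse pairs it with \<open>?Q\<close> to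
      a constant and leaves the hypergeometric term.\<close>
    also have "\<dots> = x ^ (\<Sum>i<N. i) * ((\<Prod>k<N. fact k) * (?P * ?Q)) * term_at \<kappa>"
      using \<open>?P \<noteq> 0\<close> by (simp add: term_at_def schur_const[OF \<kappa>])
    finally show ?thesis by (simp only: prod_rGamma_beta_number)
  qed
  have "((\<lambda>\<kappa>. fdet N (\<lambda>i. f (beta_number N \<kappa> i)) * fdet N (\<lambda>i. g (beta_number N \<kappa> i)))
      has_sum fdet N (\<lambda>j k. \<Sum>n. f n j * g n k)) (partitions_upto N)"
    by (rule andreief_has_sum) (unfold f_def g_def, rule moment_series(1))
  then have inf: "infsum (\<lambda>\<kappa>. fdet N (\<lambda>i. f (beta_number N \<kappa> i)) * fdet N (\<lambda>i. g (beta_number N \<kappa> i)))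
      (partitions_upto N) = x ^ (\<Sum>i<N. i) * ?D"
    unfolding lhs by (rule infsumI)
  have "x ^ (\<Sum>i<N. i) * ?D = infsum (\<lambda>\<kappa>. x ^ (\<Sum>i<N. i) * ?C * term_at \<kappa>) (partitions_upto N)"
    unfolding inf[symmetric] by (rule infsum_cong) (rule terms)
  also have "\<dots> = x ^ (\<Sum>i<N. i) * ?C * infsum term_at (partitions_upto N)"
    by (rule infsum_cmult_right')
  also have "infsum term_at (partitions_upto N) = hypergeom_pFq N [] [of_nat N + a] (\<lambda>_. x)"
    by (simp add: hypergeom_pFq_def term_at_def[abs_def])
  finally have "x ^ (\<Sum>i<N. i) * ?D =
      x ^ (\<Sum>i<N. i) * (?C * hypergeom_pFq N [] [of_nat N + a] (\<lambda>_. x))"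
    by (simp only: mult.assoc)
  then show ?thesis using x by (simp only: mult_left_cancel power_not_zero not_False_eq_True)
qed

text \<open>For \<open>\<mu> = 0\<close> the lower parameter \<open>N - 1\<close> has vanishing
  generalised Pochhammer symbols at partitions with \<open>N\<close> nonzero parts; hence the
  condition on the second formula.\<close>

theorem mainTheorem8:
  fixes \<mu> t s :: complex
  assumes sqrt_t: "s\<^sup>2 = t"
    and general: "\<And>n::nat. n \<ge> 1 \<Longrightarrow> \<mu> \<noteq> - of_nat n"
    and nonzero: "\<And>N. N \<ge> 1 \<Longrightarrow> bessel_toeplitz \<mu> 0 s N \<noteq> 0"
  shows "\<forall>N\<ge>1.
      refl_coeff \<mu> s N =
        (-1) ^ N * (s / 2) ^ N * (1 / pochhammer (\<mu> + 1) N) *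
        (hypergeom_pFq N [] [of_nat N + 1 + \<mu>] (\<lambda>_. t / 4) /
         hypergeom_pFq N [] [of_nat N + \<mu>] (\<lambda>_. t / 4)) \<and>
      (\<mu> \<noteq> 0 \<longrightarrow>
       refl_coeff_bar \<mu> s N =
        (-1) ^ N * (2 / s) ^ N * pochhammer \<mu> N *
        (hypergeom_pFq N [] [of_nat N - 1 + \<mu>] (\<lambda>_. t / 4) /
         hypergeom_pFq N [] [of_nat N + \<mu>] (\<lambda>_. t / 4)))"
proof (intro allI impI)
  fix N :: nat assume N: "N \<ge> 1"
  let ?H = "\<lambda>b. hypergeom_pFq N [] [b] (\<lambda>_. t / 4)"
  show "refl_coeff \<mu> s N =
        (-1) ^ N * (s / 2) ^ N * (1 / pochhammer (\<mu> + 1) N) *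
        (?H (of_nat N + 1 + \<mu>) / ?H (of_nat N + \<mu>)) \<and>
      (\<mu> \<noteq> 0 \<longrightarrow> refl_coeff_bar \<mu> s N =
        (-1) ^ N * (2 / s) ^ N * pochhammer \<mu> N *
        (?H (of_nat N - 1 + \<mu>) / ?H (of_nat N + \<mu>)))"
  proof (cases "s = 0")
    case True
    \<comment> \<open>At \<open>s = 0\<close> the case \<open>N = 1\<close> of
      \<open>nonzero\<close> forces \<open>\<mu> = 0\<close>. The matrix of \<open>r_N\<close> is
      then strictly upper triangular, so both sides of the first formula vanish, and the second one
      is vacuous.\<close>
    have "bessel_toeplitz \<mu> 0 s 1 = bessel_I \<mu> 0"
      using True fdet_leibniz[of 1 "\<lambda>j k. bessel_I (\<mu> + of_nat j - of_nat k) 0"]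
      by (simp add: bessel_toeplitz_def fdet_def permutes_empty lessThan_Suc permutes_sing)
    then have "bessel_I \<mu> 0 \<noteq> 0" using nonzero[of 1] by simp
    then have \<mu>: "\<mu> = 0" by (auto simp: bessel_I_def split: if_splits)
    have I: "bessel_I (1 + of_nat j - of_nat k) 0 = 0" if "k \<le> j" for j k :: nat
    proof -
      have "1 + of_nat j - of_nat k = (of_nat (Suc (j - k)) :: complex)"
        using that by (simp add: of_nat_diff)
      then have "1 + of_nat j - of_nat k \<noteq> (0 :: complex)" by (metis of_nat_neq_0)
      then show ?thesis by (simp add: bessel_I_def)
    qed
    have "bessel_toeplitz \<mu> 1 s N = fdet N (\<lambda>j k. bessel_I (1 + of_nat j - of_nat k) 0)"
      by (simp add: bessel_toeplitz_def fdet_def True \<mu>)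
    also have "\<dots> = 0"
      using N I[of 0 0] by (subst fdet_upper_triangular) (auto simp: I)
    finally show ?thesis using True \<mu> N by (simp add: refl_coeff_def)
  next
    case False
    define p where "p = (s / 2) powr \<mu>"
    define c :: complex where "c = (\<Prod>k<N. fact k)"
    define R where "R a = (\<Prod>i<N. rGamma (a + 1 + of_nat i))" for a :: complex
    have x: "t / 4 \<noteq> 0" using False sqrt_t by auto
    have T: "bessel_toeplitz \<mu> \<epsilon> s N =
        ((s / 2) powr (\<mu> + \<epsilon>)) ^ N * (c * R (\<mu> + \<epsilon>) * ?H (of_nat N + (\<mu> + \<epsilon>)))"
      if "\<And>n::nat. n \<ge> 1 \<Longrightarrow> \<mu> + \<epsilon> \<noteq> - of_nat n" for \<epsilon>
      using bessel_toeplitz_eq[OF False, of \<mu> \<epsilon> N] fdet_bessel_series[OF that x, of N]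
      by (simp only: c_def R_def sqrt_t)
    have T0: "bessel_toeplitz \<mu> 0 s N = p ^ N * (c * R \<mu> * ?H (of_nat N + \<mu>))"
      using T[of 0] general by (simp add: p_def)
    \<comment> \<open>Nonvanishing of the Toeplitz determinant passes to each factor and permits the
      cancellations below.\<close>
    then have nz: "p \<noteq> 0" "c \<noteq> 0" "R \<mu> \<noteq> 0" "?H (of_nat N + \<mu>) \<noteq> 0"
      using nonzero[OF N] N by auto
    have \<mu>1: "\<mu> + 1 \<noteq> - of_nat n" if "n \<ge> 1" for n :: nat
    proof
      assume "\<mu> + 1 = - of_nat n"
      then have "\<mu> = - of_nat (Suc n)" by (simp add: eq_diff_eq[symmetric])
      then show False using general[of "Suc n"] by simp
    qed
    have p1: "(s / 2) powr (\<mu> + 1) = p * (s / 2)"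
      using False by (simp add: p_def powr_add)
    have N1: "of_nat N + (\<mu> + 1) = of_nat N + 1 + \<mu>" by simp
    have "bessel_toeplitz \<mu> 1 s N =
        p ^ N * (s / 2) ^ N * (c * R (\<mu> + 1) * ?H (of_nat N + 1 + \<mu>))"
      unfolding power_mult_distrib[symmetric] p1[symmetric] N1[symmetric]
        by (rule T, rule \<mu>1)
    \<comment> \<open>As \<open>R \<mu>\<close> is nonzero, so are both factors on the
      right.\<close>
    moreover have R1: "R \<mu> = pochhammer (\<mu> + 1) N * R (\<mu> + 1)"
      unfolding R_def by (rule prod_rGamma_shift)
    ultimately have "refl_coeff \<mu> s N =
        (-1) ^ N * (s / 2) ^ N * (1 / pochhammer (\<mu> + 1) N) *
        (?H (of_nat N + 1 + \<mu>) / ?H (of_nat N + \<mu>))"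
      using nz unfolding refl_coeff_def T0 R1 by simp
    moreover have "refl_coeff_bar \<mu> s N =
        (-1) ^ N * (2 / s) ^ N * pochhammer \<mu> N *
        (?H (of_nat N - 1 + \<mu>) / ?H (of_nat N + \<mu>))" if "\<mu> \<noteq> 0"
    proof -
      \<comment> \<open>The value \<open>n = 1\<close> would mean \<open>\<mu> = 0\<close>; larger
        \<open>n\<close> contradict \<open>general\<close>.\<close>
      have \<mu>1: "\<mu> + -1 \<noteq> - of_nat n" if "n \<ge> 1" for n :: nat
      proof
        assume "\<mu> + -1 = - of_nat n"
        then have "\<mu> = - of_nat (n - 1)" using that by (simp add: of_nat_diff diff_eq_eq)
        moreover from this \<open>\<mu> \<noteq> 0\<close> have "n - 1 \<ge> 1" by (cases "n - 1 = 0") auto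
        ultimately show False using general by blast
      qed
      have p1: "(s / 2) powr (\<mu> + -1) = p * (2 / s)"
        using False by (simp add: p_def powr_diff)
      have N1: "of_nat N + (\<mu> + -1) = of_nat N - 1 + \<mu>" by simp
      have "bessel_toeplitz \<mu> (-1) s N =
          p ^ N * (2 / s) ^ N * (c * R (\<mu> + -1) * ?H (of_nat N - 1 + \<mu>))"
        unfolding power_mult_distrib[symmetric] p1[symmetric] N1[symmetric]
        by (rule T, rule \<mu>1)
      moreover have "R (\<mu> + -1) = pochhammer \<mu> N * R \<mu>"
        using prod_rGamma_shift[of \<mu> N] by (simp add: R_def)
      ultimately show ?thesis
        using nz unfolding refl_coeff_bar_def T0 by simp
    qed
    ultimately show ?thesis by blast
  qed
qed

end
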